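(* Let $N\ge2$, let $\mathcal C\subset\mathbb R^N$ be an unbounded Lipschitz domain, and let $\Omega\subset\mathcal C$ be a bounded domain such that $\Gamma_\Omega=\partial\Omega\cap\mathcal C$ is Lipschitz. Let $\lambda_1(\Omega)$ be the first eigenvalue of the mixed problem $$-\Delta u=\lambda u\text{ in }\Omega,\qquad u=0\text{ on }\Gamma_\Omega,\qquad \frac{\partial u}{\partial\nu}=0\text{ on }\Gamma_{1,\Omega}=\partial\Omega\cap\partial\mathcal C.$$ Then $$\lambda_1(\Omega)\ge\frac{h_{\mathcal C}(\Omega)^2}{4},$$ where $h_{\mathcal C}(\Omega)$ is the relative (to $\mathcal C$) Cheeger constant of $\Omega$.
   Context: Let $H^1_0(\Omega\cup\Gamma_{1,\Omega})$ be the closure in $H^1(\Omega)$ of $C_c^1(\Omega\cup\Gamma_{1,\Omega})$. The first eigenvalue is characterized by $$\lambda_1(\Omega)=\min_{v\in H_0^1(\Omega\cup\Gamma_{1,\Omega})\setminus\{0\}}\frac{\int_\Omega|\nabla v|^2\,dx}{\int_\Omega v^2\,dx}.$$ The relative perimeter of $E\subset\mathcal C$ is $P_{\mathcal C}(E)=\sup\{\int_E\operatorname{div}\psi\,dx:\psi\in C_c^1(\mathcal C,\mathbb R^N),\|\psi\|_\infty\le1\}$. $|E|$ is the Lebesgue measure. The relative Cheeger constant is $h_{\mathcal C}(\Omega)=\inf_{E\subseteq\Omega}P_{\mathcal C}(E)/|E|$ (over measurable $E\subseteq\Omega$ with $|E|>0$). The vector $\nu$ is the exterior unit normal to $\Omega$.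 *)

theory Defs
  imports "HOL-Analysis.Analysis"
begin

section \<open>Domains and Lipschitz boundaries\<close>

definition is_domain :: "'a::euclidean_space set \<Rightarrow> bool" where
  "is_domain U \<longleftrightarrow> open U \<and> connected U \<and> U \<noteq> {}"

text \<open>
  For a unit vector \<open>e\<close>, a point \<open>y\<close> has height \<open>y \<bullet> e\<close> above its projection
  \<open>y - (y \<bullet> e) *\<^sub>R e\<close> to the hyperplane orthogonal to \<open>e\<close>; a Lipschitz graph is given by
  a Lipschitz function of that projection.
\<close>

definition lipschitz_domain :: "'a::euclidean_space set \<Rightarrow> bool" where
  "lipschitz_domain U \<longleftrightarrow> is_domain U \<and>
     (\<forall>x\<in>frontier U. \<exists>r e L (\<gamma> :: 'a \<Rightarrow> real). 0 < r \<and> norm e = 1 \<and> L-lipschitz_on UNIV \<gamma> \<and>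
        U \<inter> ball x r = {y \<in> ball x r. \<gamma> (y - (y \<bullet> e) *\<^sub>R e) < y \<bullet> e})"

definition lipschitz_hypersurface :: "'a::euclidean_space set \<Rightarrow> bool" where
  "lipschitz_hypersurface S \<longleftrightarrow>
     (\<forall>x\<in>S. \<exists>r e L (\<gamma> :: 'a \<Rightarrow> real). 0 < r \<and> norm e = 1 \<and> L-lipschitz_on UNIV \<gamma> \<and>
        S \<inter> ball x r = {y \<in> ball x r. \<gamma> (y - (y \<bullet> e) *\<^sub>R e) = y \<bullet> e})"

definition Gamma0 :: "'a::euclidean_space set \<Rightarrow> 'a set \<Rightarrow> 'a set" where
  "Gamma0 C \<Omega> = frontier \<Omega> \<inter> C"

definition Gamma1 :: "'a::euclidean_space set \<Rightarrow> 'a set \<Rightarrow> 'a set" where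
  "Gamma1 C \<Omega> = frontier \<Omega> \<inter> frontier C"


section \<open>Compactly supported continuously differentiable functions\<close>

text \<open>
  For \<open>U\<close> open and \<open>U \<subseteq> S \<subseteq> closure U\<close>, \<open>C1c U S\<close> is the space of functions in
  \<open>C\<^sup>1(S)\<close> with compact support in \<open>S\<close>: the functions are differentiable in \<open>U\<close>, and they and their
  derivatives are continuous up to \<open>S\<close>.  For open \<open>U\<close>, \<open>C1c U U\<close> is the usual space
  of compactly supported \<open>C\<^sup>1\<close> functions on \<open>U\<close>.  Values outside \<open>S\<close> are irrelevant.
\<close>

definition C1c :: "'a::euclidean_space set \<Rightarrow> 'a set \<Rightarrow> ('a \<Rightarrow> 'b::euclidean_space) set" where
  "C1c U S = {f. \<exists>f' :: 'a \<Rightarrow> 'a \<Rightarrow>\<^sub>L 'b.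
     (\<forall>x\<in>U. (f has_derivative blinfun_apply (f' x)) (at x)) \<and>
     continuous_on S f \<and> continuous_on S f' \<and>
     (\<exists>K. compact K \<and> K \<subseteq> S \<and> (\<forall>x\<in>S - K. f x = 0))}"

definition partial_deriv :: "'a::euclidean_space \<Rightarrow> ('a \<Rightarrow> real) \<Rightarrow> 'a \<Rightarrow> real" where
  "partial_deriv b f x = frechet_derivative f (at x) b"

definition grad :: "('a::euclidean_space \<Rightarrow> real) \<Rightarrow> 'a \<Rightarrow> 'a" where
  "grad f x = (\<Sum>b\<in>Basis. partial_deriv b f x *\<^sub>R b)"

definition divergence :: "('a::euclidean_space \<Rightarrow> 'a) \<Rightarrow> 'a \<Rightarrow> real" where
  "divergence \<psi> x = (\<Sum>b\<in>Basis. frechet_derivative \<psi> (at x) b \<bullet> b)"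


section \<open>Relative perimeter and relative Cheeger constant\<close>

definition relative_perimeter :: "'a::euclidean_space set \<Rightarrow> 'a set \<Rightarrow> ereal" where
  "relative_perimeter C E =
     (SUP \<psi>\<in>{\<psi>\<in>C1c C C. \<forall>x\<in>C. norm (\<psi> x) \<le> 1}. ereal (LINT x:E|lebesgue. divergence \<psi> x))"

definition relative_cheeger :: "'a::euclidean_space set \<Rightarrow> 'a set \<Rightarrow> ereal" where
  "relative_cheeger C \<Omega> =
     (INF E\<in>{E \<in> sets lebesgue. E \<subseteq> \<Omega> \<and> 0 < measure lebesgue E}.
        relative_perimeter C E / ereal (measure lebesgue E))"


section \<open>Sobolev spaces\<close>

definition square_integrable :: "'a::euclidean_space set \<Rightarrow> ('a \<Rightarrow> 'b::euclidean_space) \<Rightarrow> bool" where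
  "square_integrable \<Omega> f \<longleftrightarrow>
     set_borel_measurable lebesgue \<Omega> f \<and> set_integrable lebesgue \<Omega> (\<lambda>x. (norm (f x))\<^sup>2)"

definition has_weak_gradient ::
    "('a::euclidean_space \<Rightarrow> real) \<Rightarrow> ('a \<Rightarrow> 'a) \<Rightarrow> 'a set \<Rightarrow> bool" where
  "has_weak_gradient u g \<Omega> \<longleftrightarrow>
     (\<forall>b\<in>Basis. \<forall>\<phi>\<in>C1c \<Omega> \<Omega>.
        (LINT x:\<Omega>|lebesgue. u x * partial_deriv b \<phi> x) = - (LINT x:\<Omega>|lebesgue. (g x \<bullet> b) * \<phi> x))"

text \<open>
  An element of \<open>H\<^sup>1(\<Omega>)\<close> is carried together with its weak gradient, which is unique up to null
  sets; as usual, functions that agree almost everywhere on \<open>\<Omega>\<close> represent the same element.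
\<close>

definition H1 :: "'a::euclidean_space set \<Rightarrow> (('a \<Rightarrow> real) \<times> ('a \<Rightarrow> 'a)) set" where
  "H1 \<Omega> = {(u, g). square_integrable \<Omega> u \<and> square_integrable \<Omega> g \<and> has_weak_gradient u g \<Omega>}"

definition H1_norm :: "'a::euclidean_space set \<Rightarrow> ('a \<Rightarrow> real) \<Rightarrow> ('a \<Rightarrow> 'a) \<Rightarrow> real" where
  "H1_norm \<Omega> u g =
     sqrt ((LINT x:\<Omega>|lebesgue. (u x)\<^sup>2) + (LINT x:\<Omega>|lebesgue. (norm (g x))\<^sup>2))"

text \<open>The closure of \<open>C1c \<Omega> (\<Omega> \<union> Gamma1 C \<Omega>)\<close> in \<open>H\<^sup>1(\<Omega>)\<close>.\<close>

definition H10 :: "'a::euclidean_space set \<Rightarrow> 'a set \<Rightarrow> (('a \<Rightarrow> real) \<times> ('a \<Rightarrow> 'a)) set" where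
  "H10 C \<Omega> = {(u, g) \<in> H1 \<Omega>. \<forall>\<epsilon>>0. \<exists>\<phi>\<in>C1c \<Omega> (\<Omega> \<union> Gamma1 C \<Omega>).
     H1_norm \<Omega> (\<lambda>x. u x - \<phi> x) (\<lambda>x. g x - grad \<phi> x) < \<epsilon>}"

definition null_function :: "'a::euclidean_space set \<Rightarrow> ('a \<Rightarrow> real) \<Rightarrow> bool" where
  "null_function \<Omega> u \<longleftrightarrow> (AE x in lebesgue. x \<in> \<Omega> \<longrightarrow> u x = 0)"


section \<open>The mixed eigenvalue problem\<close>

text \<open>
  Weak formulation: the Dirichlet condition on \<open>Gamma0 C \<Omega>\<close> is encoded in the space \<open>H10\<close>, and the
  Neumann condition on \<open>Gamma1 C \<Omega>\<close> is the natural boundary condition, obtained from testing with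
  functions that need not vanish there.  The first eigenvalue is the least one; it is written as an
  infimum in the extended reals so that no existence assumption enters its definition.
\<close>

definition mixed_eigenvalue :: "'a::euclidean_space set \<Rightarrow> 'a set \<Rightarrow> real \<Rightarrow> bool" where
  "mixed_eigenvalue C \<Omega> \<mu> \<longleftrightarrow>
     (\<exists>(u, g)\<in>H10 C \<Omega>. \<not> null_function \<Omega> u \<and>
        (\<forall>(v, h)\<in>H10 C \<Omega>.
           (LINT x:\<Omega>|lebesgue. g x \<bullet> h x) = \<mu> * (LINT x:\<Omega>|lebesgue. u x * v x)))"

definition first_eigenvalue :: "'a::euclidean_space set \<Rightarrow> 'a set \<Rightarrow> ereal" where
  "first_eigenvalue C \<Omega> = (INF \<mu>\<in>{\<mu>. mixed_eigenvalue C \<Omega> \<mu>}. ereal \<mu>)"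

definition rayleigh :: "'a::euclidean_space set \<Rightarrow> ('a \<Rightarrow> real) \<Rightarrow> ('a \<Rightarrow> 'a) \<Rightarrow> real" where
  "rayleigh \<Omega> u g = (LINT x:\<Omega>|lebesgue. (norm (g x))\<^sup>2) / (LINT x:\<Omega>|lebesgue. (u x)\<^sup>2)"

text \<open>
  The rest of this theory shows that \<open>first_eigenvalue\<close> is the value given by the variational
  characterization: whenever the Rayleigh quotient attains its minimum over the nonzero elements of
  \<open>H10\<close>, that minimum is the first eigenvalue.
\<close>

lemma square_integrable_inner:
  fixes f g :: "'a::euclidean_space \<Rightarrow> 'b::euclidean_space"
  assumes "square_integrable \<Omega> f" "square_integrable \<Omega> g"
  shows "set_integrable lebesgue \<Omega> (\<lambda>x. f x \<bullet> g x)"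
proof -
  have m: "(\<lambda>x. indicator \<Omega> x *\<^sub>R f x) \<in> borel_measurable lebesgue"
      "(\<lambda>x. indicator \<Omega> x *\<^sub>R g x) \<in> borel_measurable lebesgue"
    using assms by (auto simp: square_integrable_def set_borel_measurable_def)
  have eq: "(\<lambda>x. indicator \<Omega> x *\<^sub>R (f x \<bullet> g x)) =
      (\<lambda>x. (indicator \<Omega> x *\<^sub>R f x) \<bullet> (indicator \<Omega> x *\<^sub>R g x))"
    by (auto simp: indicator_def)
  have b: "norm (f x \<bullet> g x) \<le> norm ((norm (f x))\<^sup>2 + (norm (g x))\<^sup>2)" for x
  proof -
    have "\<bar>f x \<bullet> g x\<bar> \<le> norm (f x) * norm (g x)" by (rule Cauchy_Schwarz_ineq2)
    also have "\<dots> \<le> (norm (f x))\<^sup>2 + (norm (g x))\<^sup>2"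
      using sum_squares_bound[of "norm (f x)" "norm (g x)"] 
        mult_nonneg_nonneg[OF norm_ge_zero[of "f x"] norm_ge_zero[of "g x"]] by linarith
    finally show ?thesis by simp
  qed
  show ?thesis
  proof (rule set_integrable_bound)
    show "set_integrable lebesgue \<Omega> (\<lambda>x. (norm (f x))\<^sup>2 + (norm (g x))\<^sup>2)"
      using assms by (auto simp: square_integrable_def)
    show "set_borel_measurable lebesgue \<Omega> (\<lambda>x. f x \<bullet> g x)"
      unfolding set_borel_measurable_def eq using m by measurable
    show "AE x in lebesgue. x \<in> \<Omega> \<longrightarrow> norm (f x \<bullet> g x) \<le> norm ((norm (f x))\<^sup>2 + (norm (g x))\<^sup>2)"
      using b by blast
  qed
qed

lemma square_integrable_lincomb:
  fixes f g :: "'a::euclidean_space \<Rightarrow> 'b::euclidean_space"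
  assumes "square_integrable \<Omega> f" "square_integrable \<Omega> g"
  shows "square_integrable \<Omega> (\<lambda>x. f x + t *\<^sub>R g x)"
  unfolding square_integrable_def
proof
  have m: "(\<lambda>x. indicator \<Omega> x *\<^sub>R f x) \<in> borel_measurable lebesgue"
      "(\<lambda>x. indicator \<Omega> x *\<^sub>R g x) \<in> borel_measurable lebesgue"
    using assms by (auto simp: square_integrable_def set_borel_measurable_def)
  have eq: "(\<lambda>x. indicator \<Omega> x *\<^sub>R (f x + t *\<^sub>R g x)) =
      (\<lambda>x. indicator \<Omega> x *\<^sub>R f x + t *\<^sub>R (indicator \<Omega> x *\<^sub>R g x))"
    by (auto simp: algebra_simps)
  show "set_borel_measurable lebesgue \<Omega> (\<lambda>x. f x + t *\<^sub>R g x)"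
    unfolding set_borel_measurable_def eq using m by measurable
  have "(\<lambda>x. (norm (f x + t *\<^sub>R g x))\<^sup>2) =
      (\<lambda>x. f x \<bullet> f x + (2 * t) * (f x \<bullet> g x) + t\<^sup>2 * (g x \<bullet> g x))"
    unfolding power2_norm_eq_inner
    by (simp add: inner_add_left inner_add_right inner_commute power2_eq_square algebra_simps)
  then show "set_integrable lebesgue \<Omega> (\<lambda>x. (norm (f x + t *\<^sub>R g x))\<^sup>2)"
    using assms by (auto intro!: set_integral_add(1) set_integrable_mult_right square_integrable_inner)
qed

lemma integral_square_lincomb:
  fixes f g :: "'a::euclidean_space \<Rightarrow> 'b::euclidean_space"
  assumes "square_integrable \<Omega> f" "square_integrable \<Omega> g"
  shows "(LINT x:\<Omega>|lebesgue. (norm (f x + t *\<^sub>R g x))\<^sup>2) =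
    (LINT x:\<Omega>|lebesgue. (norm (f x))\<^sup>2) + 2 * t * (LINT x:\<Omega>|lebesgue. f x \<bullet> g x) +
    t\<^sup>2 * (LINT x:\<Omega>|lebesgue. (norm (g x))\<^sup>2)"
proof -
  have eq: "(\<lambda>x. (norm (f x + t *\<^sub>R g x))\<^sup>2) =
      (\<lambda>x. f x \<bullet> f x + (2 * t) * (f x \<bullet> g x) + t\<^sup>2 * (g x \<bullet> g x))"
    unfolding power2_norm_eq_inner
    by (simp add: inner_add_left inner_add_right inner_commute power2_eq_square algebra_simps)
  note i = square_integrable_inner[OF assms(1,1)] square_integrable_inner[OF assms]
     square_integrable_inner[OF assms(2,2)]
  show ?thesis unfolding eq
    using i by (simp add: power2_norm_eq_inner)
qed

lemma C1c_grad:
  assumes "open \<Omega>" "\<phi> \<in> C1c \<Omega> S" "\<Omega> \<subseteq> S"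
  obtains \<phi>' :: "'a::euclidean_space \<Rightarrow> 'a \<Rightarrow>\<^sub>L real" and K where
    "\<And>x. x \<in> \<Omega> \<Longrightarrow> (\<phi> has_derivative blinfun_apply (\<phi>' x)) (at x)"
    "\<And>x b. x \<in> \<Omega> \<Longrightarrow> partial_deriv b \<phi> x = \<phi>' x b"
    "continuous_on S \<phi>" "continuous_on S \<phi>'" "compact K" "K \<subseteq> S"
    "\<And>x. x \<in> S - K \<Longrightarrow> \<phi> x = 0" "\<And>x. x \<in> \<Omega> - K \<Longrightarrow> \<phi>' x = 0"
proof -
  obtain \<phi>' K where *: "\<And>x. x \<in> \<Omega> \<Longrightarrow> (\<phi> has_derivative blinfun_apply (\<phi>' x)) (at x)"
    "continuous_on S \<phi>" "continuous_on S \<phi>'" "compact K" "K \<subseteq> S"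
    "\<And>x. x \<in> S - K \<Longrightarrow> \<phi> x = 0"
    using assms(2) unfolding C1c_def by (auto simp: Ball_def)
  have p: "partial_deriv b \<phi> x = \<phi>' x b" if "x \<in> \<Omega>" for x b
    using frechet_derivative_at[OF *(1)[OF that]] by (simp add: partial_deriv_def)
  have z: "\<phi>' x = 0" if "x \<in> \<Omega> - K" for x
  proof -
    have "open (\<Omega> - K)" using assms(1) *(4) by (simp add: compact_imp_closed open_Diff)
    then have "(\<phi> has_derivative (\<lambda>h. 0)) (at x)"
      using that *(6) assms(3)
      by (intro has_derivative_transform_within_open[of "\<lambda>_. 0" "\<lambda>h. 0" x UNIV "\<Omega> - K" \<phi>])
         (auto intro: derivative_eq_intros)
    then have "blinfun_apply (\<phi>' x) = (\<lambda>h. 0)"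
      using *(1)[of x] that by (intro has_derivative_unique) auto
    then show ?thesis by (intro blinfun_eqI) simp
  qed
  show thesis using * p z by (intro that)
qed

lemma compact_support_square_integrable:
  fixes f :: "'a::euclidean_space \<Rightarrow> 'b::euclidean_space"
  assumes "open \<Omega>" "\<Omega> \<subseteq> S" "continuous_on S f" "compact K" "K \<subseteq> S" "\<And>x. x \<in> \<Omega> - K \<Longrightarrow> f x = 0"
  shows "square_integrable \<Omega> f"
proof -
  have mS: "\<Omega> \<in> sets lebesgue" using assms(1) by auto
  have c: "continuous_on \<Omega> f" "continuous_on K f" using assms continuous_on_subset by blast+
  have m: "set_borel_measurable lebesgue \<Omega> f" unfolding set_borel_measurable_def
    using borel_measurable_continuous_on_indicator[of \<Omega> f] assms(1) c(1)
    by (intro measurable_completion) auto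
  have m2: "set_borel_measurable lebesgue \<Omega> (\<lambda>x. (norm (f x))\<^sup>2)" unfolding set_borel_measurable_def
    using borel_measurable_continuous_on_indicator[of \<Omega> "\<lambda>x. (norm (f x))\<^sup>2"] assms(1)
      continuous_on_power[OF continuous_on_norm[OF c(1)], of 2]
    by (intro measurable_completion) auto
  obtain B where B: "\<And>x. x \<in> K \<Longrightarrow> norm (f x) \<le> B"
    using compact_continuous_image[OF c(2) assms(4)] by (metis compact_imp_bounded bounded_iff imageI)
  have "integrable lebesgue (\<lambda>x. indicator K x *\<^sub>R B\<^sup>2)"
    using assms(4) lmeasurable_compact[of K]
    by (auto simp: fmeasurable_def intro!: integrable_scaleR_left)
  then have "set_integrable lebesgue \<Omega> (\<lambda>x. indicator K x *\<^sub>R B\<^sup>2)"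
    unfolding set_integrable_def using mS by (rule integrable_mult_indicator[rotated])
  then have "set_integrable lebesgue \<Omega> (\<lambda>x. (norm (f x))\<^sup>2)"
  proof (rule set_integrable_bound[OF _ m2])
    have "norm ((norm (f x))\<^sup>2) \<le> norm (indicator K x *\<^sub>R B\<^sup>2)" if "x \<in> \<Omega>" for x
      using assms(6)[of x] B[of x] that by (cases "x \<in> K") (auto simp: power_mono)
    then show "AE x in lebesgue. x \<in> \<Omega> \<longrightarrow> norm ((norm (f x))\<^sup>2) \<le> norm (indicator K x *\<^sub>R B\<^sup>2)"
      by blast
  qed
  with m show ?thesis by (simp add: square_integrable_def)
qed

lemma square_integrable_cong:
  assumes "\<And>x. x \<in> \<Omega> \<Longrightarrow> f x = g x"
  shows "square_integrable \<Omega> f \<longleftrightarrow> square_integrable \<Omega> g"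
proof -
  have "(\<lambda>x. indicator \<Omega> x *\<^sub>R f x) = (\<lambda>x. indicator \<Omega> x *\<^sub>R g x)"
    "(\<lambda>x. indicator \<Omega> x *\<^sub>R (norm (f x))\<^sup>2) = (\<lambda>x. indicator \<Omega> x *\<^sub>R (norm (g x))\<^sup>2)"
    using assms by (auto simp: fun_eq_iff split: split_indicator)
  then show ?thesis
    by (simp add: square_integrable_def set_borel_measurable_def set_integrable_def)
qed

lemma C1c_square_integrable:
  assumes "open \<Omega>" "\<Omega> \<subseteq> S" "\<phi> \<in> C1c \<Omega> S"
  shows "square_integrable \<Omega> \<phi>" "square_integrable \<Omega> (partial_deriv b \<phi>)" "square_integrable \<Omega> (grad \<phi>)"
proof -
  obtain \<phi>' K where *: "\<And>x. x \<in> \<Omega> \<Longrightarrow> (\<phi> has_derivative blinfun_apply (\<phi>' x)) (at x)"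
    "\<And>x b. x \<in> \<Omega> \<Longrightarrow> partial_deriv b \<phi> x = \<phi>' x b"
    "continuous_on S \<phi>" "continuous_on S \<phi>'" "compact K" "K \<subseteq> S"
    "\<And>x. x \<in> S - K \<Longrightarrow> \<phi> x = 0" "\<And>x. x \<in> \<Omega> - K \<Longrightarrow> \<phi>' x = 0"
    by (rule C1c_grad[OF assms(1,3,2)]) (rule that)
  show "square_integrable \<Omega> \<phi>"
    using *(7) assms(2) by (intro compact_support_square_integrable[OF assms(1,2) *(3,5,6)]) auto
  have "square_integrable \<Omega> (\<lambda>x. \<phi>' x b)"
    using *(8) by (intro compact_support_square_integrable[OF assms(1,2) _ *(5,6)])
      (auto intro!: continuous_intros *(4))
  then show "square_integrable \<Omega> (partial_deriv b \<phi>)"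
    using *(2) square_integrable_cong[of \<Omega> "partial_deriv b \<phi>" "\<lambda>x. \<phi>' x b"] by simp
  have "square_integrable \<Omega> (\<lambda>x. \<Sum>b\<in>Basis. \<phi>' x b *\<^sub>R b)"
    using *(8) by (intro compact_support_square_integrable[OF assms(1,2) _ *(5,6)])
      (auto intro!: continuous_intros *(4))
  then show "square_integrable \<Omega> (grad \<phi>)"
    using *(2) square_integrable_cong[of \<Omega> "grad \<phi>" "\<lambda>x. \<Sum>b\<in>Basis. \<phi>' x b *\<^sub>R b"]
    by (simp add: grad_def)
qed

lemma C1c_lincomb:
  fixes \<phi> \<psi> :: "'a::euclidean_space \<Rightarrow> real"
  assumes "\<phi> \<in> C1c U S" "\<psi> \<in> C1c U S"
  shows "(\<lambda>x. \<phi> x + t * \<psi> x) \<in> C1c U S"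
    and "x \<in> U \<Longrightarrow> grad (\<lambda>x. \<phi> x + t * \<psi> x) x = grad \<phi> x + t *\<^sub>R grad \<psi> x"
proof -
  obtain \<phi>' K where p: "\<And>x. x \<in> U \<Longrightarrow> (\<phi> has_derivative blinfun_apply (\<phi>' x)) (at x)"
    "continuous_on S \<phi>" "continuous_on S \<phi>'" "compact K" "K \<subseteq> S"
    "\<And>x. x \<in> S - K \<Longrightarrow> \<phi> x = 0"
    using assms(1) unfolding C1c_def by (auto simp: Ball_def)
  obtain \<psi>' L where q: "\<And>x. x \<in> U \<Longrightarrow> (\<psi> has_derivative blinfun_apply (\<psi>' x)) (at x)"
    "continuous_on S \<psi>" "continuous_on S \<psi>'" "compact L" "L \<subseteq> S"
    "\<And>x. x \<in> S - L \<Longrightarrow> \<psi> x = 0"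
    using assms(2) unfolding C1c_def by (auto simp: Ball_def)
  have d: "((\<lambda>x. \<phi> x + t * \<psi> x) has_derivative blinfun_apply (\<phi>' x + t *\<^sub>R \<psi>' x)) (at x)"
    if "x \<in> U" for x
    using p(1)[OF that] q(1)[OF that]
    by (auto intro!: derivative_eq_intros simp: blinfun.add_left blinfun.scaleR_left)
  show "(\<lambda>x. \<phi> x + t * \<psi> x) \<in> C1c U S" unfolding C1c_def
  proof (intro CollectI exI conjI)
    show "\<forall>x\<in>U. ((\<lambda>x. \<phi> x + t * \<psi> x) has_derivative blinfun_apply (\<phi>' x + t *\<^sub>R \<psi>' x)) (at x)"
      using d by blast
    show "compact (K \<union> L)" using p(4) q(4) by (rule compact_Un)
  qed (use p q in \<open>auto intro!: continuous_intros\<close>)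
  show "grad (\<lambda>x. \<phi> x + t * \<psi> x) x = grad \<phi> x + t *\<^sub>R grad \<psi> x" if "x \<in> U"
    using frechet_derivative_at[OF d[OF that], symmetric]
      frechet_derivative_at[OF p(1)[OF that], symmetric]
      frechet_derivative_at[OF q(1)[OF that], symmetric]
    by (simp add: grad_def partial_deriv_def blinfun.add_left blinfun.scaleR_left
        scaleR_add_left sum.distrib scaleR_sum_right)
qed

lemma integral_square_sum_le:
  fixes f g :: "'a::euclidean_space \<Rightarrow> 'b::euclidean_space"
  assumes "square_integrable \<Omega> f" "square_integrable \<Omega> g"
  shows "(LINT x:\<Omega>|lebesgue. (norm (f x + t *\<^sub>R g x))\<^sup>2) \<le>
    2 * (LINT x:\<Omega>|lebesgue. (norm (f x))\<^sup>2) + 2 * t\<^sup>2 * (LINT x:\<Omega>|lebesgue. (norm (g x))\<^sup>2)"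
proof -
  have "0 \<le> (LINT x:\<Omega>|lebesgue. (norm (f x + (-t) *\<^sub>R g x))\<^sup>2)"
    by (auto simp: set_lebesgue_integral_def)
  then show ?thesis
    using integral_square_lincomb[OF assms, of t] integral_square_lincomb[OF assms, of "-t"]
    by simp
qed

lemma H10_lincomb:
  assumes "open \<Omega>" and u: "(u, g) \<in> H10 C \<Omega>" and v: "(v, h) \<in> H10 C \<Omega>"
  shows "(\<lambda>x. u x + t * v x, \<lambda>x. g x + t *\<^sub>R h x) \<in> H10 C \<Omega>"
proof -
  let ?S = "\<Omega> \<union> Gamma1 C \<Omega>"
  have s: "square_integrable \<Omega> u" "square_integrable \<Omega> g" "square_integrable \<Omega> v" "square_integrable \<Omega> h"
    and w: "has_weak_gradient u g \<Omega>" "has_weak_gradient v h \<Omega>"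
    using u v by (auto simp: H10_def H1_def)
  have "has_weak_gradient (\<lambda>x. u x + t * v x) (\<lambda>x. g x + t *\<^sub>R h x) \<Omega>"
    unfolding has_weak_gradient_def
  proof (intro ballI)
    fix b :: 'a and \<phi> :: "'a \<Rightarrow> real" assume b: "b \<in> Basis" and \<phi>: "\<phi> \<in> C1c \<Omega> \<Omega>"
    have si: "square_integrable \<Omega> \<phi>" "square_integrable \<Omega> (partial_deriv b \<phi>)"
      using C1c_square_integrable[OF assms(1) order_refl \<phi>] by auto
    have sb: "square_integrable \<Omega> (\<lambda>x. k x \<bullet> b)" if k: "square_integrable \<Omega> k" for k :: "'a \<Rightarrow> 'a"
    proof -
      have "(\<lambda>x. indicator \<Omega> x *\<^sub>R (k x \<bullet> b)) = (\<lambda>x. (indicator \<Omega> x *\<^sub>R k x) \<bullet> b)"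
        by auto
      moreover have "(\<lambda>x. indicator \<Omega> x *\<^sub>R k x) \<in> borel_measurable lebesgue"
        using k by (auto simp: square_integrable_def set_borel_measurable_def)
      ultimately have m: "set_borel_measurable lebesgue \<Omega> (\<lambda>x. k x \<bullet> b)"
        unfolding set_borel_measurable_def by (simp only: borel_measurable_inner borel_measurable_const)
      have e: "(\<lambda>x. indicator \<Omega> x *\<^sub>R (k x \<bullet> b)\<^sup>2) = (\<lambda>x. (indicator \<Omega> x *\<^sub>R (k x \<bullet> b))\<^sup>2)"
        by (auto simp: indicator_def)
      have m2: "set_borel_measurable lebesgue \<Omega> (\<lambda>x. (norm (k x \<bullet> b))\<^sup>2)"
        using borel_measurable_power[OF m[unfolded set_borel_measurable_def], of 2]
        unfolding set_borel_measurable_def by (simp add: e del: real_scaleR_def)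
      have "(norm (k x \<bullet> b))\<^sup>2 \<le> (norm (k x))\<^sup>2" for x
        using Basis_le_norm[OF b, of "k x"] by (intro power_mono) auto
      then have "set_integrable lebesgue \<Omega> (\<lambda>x. (norm (k x \<bullet> b))\<^sup>2)"
        using k by (intro set_integrable_bound[OF _ m2, of "\<lambda>x. (norm (k x))\<^sup>2"])
          (auto simp: square_integrable_def)
      with m show ?thesis by (simp add: square_integrable_def)
    qed
    have I: "set_integrable lebesgue \<Omega> (\<lambda>x. p x * q x)"
      if "square_integrable \<Omega> p" "square_integrable \<Omega> q" for p q :: "'a \<Rightarrow> real"
      using square_integrable_inner[OF that] by simp
    have L: "(\<lambda>x. (u x + t * v x) * partial_deriv b \<phi> x) =
        (\<lambda>x. u x * partial_deriv b \<phi> x + t * (v x * partial_deriv b \<phi> x))"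
      and R: "(\<lambda>x. ((g x + t *\<^sub>R h x) \<bullet> b) * \<phi> x) = (\<lambda>x. (g x \<bullet> b) * \<phi> x + t * ((h x \<bullet> b) * \<phi> x))"
      by (auto simp: algebra_simps inner_add_left)
    have "(LINT x:\<Omega>|lebesgue. (u x + t * v x) * partial_deriv b \<phi> x) =
        (LINT x:\<Omega>|lebesgue. u x * partial_deriv b \<phi> x) + t * (LINT x:\<Omega>|lebesgue. v x * partial_deriv b \<phi> x)"
      unfolding L using I s si by simp
    moreover have "(LINT x:\<Omega>|lebesgue. ((g x + t *\<^sub>R h x) \<bullet> b) * \<phi> x) =
        (LINT x:\<Omega>|lebesgue. (g x \<bullet> b) * \<phi> x) + t * (LINT x:\<Omega>|lebesgue. (h x \<bullet> b) * \<phi> x)"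
      unfolding R using I sb s si by simp
    ultimately show "(LINT x:\<Omega>|lebesgue. (u x + t * v x) * partial_deriv b \<phi> x) =
        - (LINT x:\<Omega>|lebesgue. ((g x + t *\<^sub>R h x) \<bullet> b) * \<phi> x)"
      using w b \<phi> by (simp add: has_weak_gradient_def)
  qed
  moreover have "square_integrable \<Omega> (\<lambda>x. u x + t * v x)" "square_integrable \<Omega> (\<lambda>x. g x + t *\<^sub>R h x)"
    using square_integrable_lincomb[OF s(1,3), of t] square_integrable_lincomb[OF s(2,4), of t] by auto
  moreover have "\<exists>\<phi>\<in>C1c \<Omega> ?S. H1_norm \<Omega> (\<lambda>x. u x + t * v x - \<phi> x) (\<lambda>x. g x + t *\<^sub>R h x - grad \<phi> x) < \<epsilon>"
    if "\<epsilon> > 0" for \<epsilon>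
  proof -
    define \<delta> where "\<delta> = \<epsilon> / (2 * (1 + \<bar>t\<bar>))"
    have \<delta>: "\<delta> > 0" using that by (simp add: \<delta>_def add_pos_nonneg)
    obtain \<phi> where \<phi>: "\<phi> \<in> C1c \<Omega> ?S" "H1_norm \<Omega> (\<lambda>x. u x - \<phi> x) (\<lambda>x. g x - grad \<phi> x) < \<delta>"
      using u \<delta> by (auto simp: H10_def)
    obtain \<psi> where \<psi>: "\<psi> \<in> C1c \<Omega> ?S" "H1_norm \<Omega> (\<lambda>x. v x - \<psi> x) (\<lambda>x. h x - grad \<psi> x) < \<delta>"
      using v \<delta> by (auto simp: H10_def)
    let ?\<chi> = "\<lambda>x. \<phi> x + t * \<psi> x"
    have sub: "\<Omega> \<subseteq> ?S" by auto
    have d: "square_integrable \<Omega> (\<lambda>x. u x - \<phi> x)" "square_integrable \<Omega> (\<lambda>x. g x - grad \<phi> x)"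
       "square_integrable \<Omega> (\<lambda>x. v x - \<psi> x)" "square_integrable \<Omega> (\<lambda>x. h x - grad \<psi> x)"
      using square_integrable_lincomb[OF s(1) C1c_square_integrable(1)[OF assms(1) sub \<phi>(1)], of "-1"]
       square_integrable_lincomb[OF s(2) C1c_square_integrable(3)[OF assms(1) sub \<phi>(1)], of "-1"]
       square_integrable_lincomb[OF s(3) C1c_square_integrable(1)[OF assms(1) sub \<psi>(1)], of "-1"]
       square_integrable_lincomb[OF s(4) C1c_square_integrable(3)[OF assms(1) sub \<psi>(1)], of "-1"]
      by simp_all
    have nn: "0 \<le> (LINT x:\<Omega>|lebesgue. (p x)\<^sup>2)" for p :: "'a \<Rightarrow> real"
      by (auto simp: set_lebesgue_integral_def)
    have sq: "(H1_norm \<Omega> p q)\<^sup>2 = (LINT x:\<Omega>|lebesgue. (p x)\<^sup>2) + (LINT x:\<Omega>|lebesgue. (norm (q x))\<^sup>2)"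
      for p and q :: "'a \<Rightarrow> 'a"
      unfolding H1_norm_def using nn[of p] nn[of "\<lambda>x. norm (q x)"] by simp
    have e1: "(\<lambda>x. (u x + t * v x - ?\<chi> x)\<^sup>2) =
        (\<lambda>x. (norm ((u x - \<phi> x) + t *\<^sub>R (v x - \<psi> x)))\<^sup>2)"
      by (auto simp: algebra_simps)
    have e2: "(LINT x:\<Omega>|lebesgue. (norm (g x + t *\<^sub>R h x - grad ?\<chi> x))\<^sup>2) =
        (LINT x:\<Omega>|lebesgue. (norm ((g x - grad \<phi> x) + t *\<^sub>R (h x - grad \<psi> x)))\<^sup>2)"
      unfolding set_lebesgue_integral_def
      by (intro Bochner_Integration.integral_cong refl)
        (auto simp: indicator_def C1c_lincomb(2)[OF \<phi>(1) \<psi>(1)] algebra_simps)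
    have "(H1_norm \<Omega> (\<lambda>x. u x + t * v x - ?\<chi> x) (\<lambda>x. g x + t *\<^sub>R h x - grad ?\<chi> x))\<^sup>2 \<le>
       2 * (H1_norm \<Omega> (\<lambda>x. u x - \<phi> x) (\<lambda>x. g x - grad \<phi> x))\<^sup>2 +
       2 * t\<^sup>2 * (H1_norm \<Omega> (\<lambda>x. v x - \<psi> x) (\<lambda>x. h x - grad \<psi> x))\<^sup>2"
      unfolding sq e1 e2
      using integral_square_sum_le[OF d(1,3), of t] integral_square_sum_le[OF d(2,4), of t]
      by (simp add: algebra_simps)
    also have "\<dots> \<le> 2 * \<delta>\<^sup>2 + 2 * t\<^sup>2 * \<delta>\<^sup>2"
      using \<phi>(2) \<psi>(2)
      by (intro add_mono mult_left_mono power_mono) (auto simp: H1_norm_def nn)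
    also have "\<dots> \<le> 2 * ((1 + \<bar>t\<bar>) * \<delta>)\<^sup>2"
      using \<delta> by (auto simp: power2_eq_square algebra_simps)
    also have "\<dots> < (2 * ((1 + \<bar>t\<bar>) * \<delta>))\<^sup>2"
      using \<delta> by (simp add: power_mult_distrib) 
    also have "2 * ((1 + \<bar>t\<bar>) * \<delta>) = \<epsilon>" by (simp add: \<delta>_def add_pos_nonneg field_simps)
    finally have "H1_norm \<Omega> (\<lambda>x. u x + t * v x - ?\<chi> x) (\<lambda>x. g x + t *\<^sub>R h x - grad ?\<chi> x) < \<epsilon>"
      using that by (meson less_imp_le power2_less_imp_less)
    then show ?thesis by (rule bexI[OF _ C1c_lincomb(1)[OF \<phi>(1) \<psi>(1)]])
  qed
  ultimately show ?thesis by (simp add: H10_def H1_def)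
qed

lemma null_function_iff:
  assumes "square_integrable \<Omega> u"
  shows "null_function \<Omega> u \<longleftrightarrow> (LINT x:\<Omega>|lebesgue. (u x)\<^sup>2) = 0"
proof -
  have "integrable lebesgue (\<lambda>x. indicator \<Omega> x *\<^sub>R (u x)\<^sup>2)"
    using assms by (simp add: square_integrable_def set_integrable_def)
  from integral_nonneg_eq_0_iff_AE[OF this]
  show ?thesis
    by (auto simp: null_function_def set_lebesgue_integral_def indicator_def)
qed

lemma quadratic_nonneg_imp_zero:
  fixes b c :: real
  assumes "\<And>t. 0 \<le> 2 * t * b + t\<^sup>2 * c"
  shows "b = 0"
proof (rule ccontr)
  assume b: "b \<noteq> 0"
  define d where "d = \<bar>c\<bar> + 1"
  have d: "d > 0" "c < d" by (auto simp: d_def)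
  have "2 * (- b / d) * b + (- b / d)\<^sup>2 * c = (b\<^sup>2 / d) * (c / d - 2)"
    using d by (simp add: field_simps power2_eq_square)
  also have "\<dots> < 0"
    using b d by (intro mult_pos_neg) (auto simp: field_simps)
  finally show False using assms[of "- b / d"] by simp
qed

theorem first_eigenvalue_eq_rayleigh_minimum:
  assumes "open \<Omega>" and u: "(u, g) \<in> H10 C \<Omega>" "\<not> null_function \<Omega> u"
    and min: "\<And>v h. (v, h) \<in> H10 C \<Omega> \<Longrightarrow> \<not> null_function \<Omega> v \<Longrightarrow> rayleigh \<Omega> u g \<le> rayleigh \<Omega> v h"
  shows "first_eigenvalue C \<Omega> = ereal (rayleigh \<Omega> u g)"
    and "mixed_eigenvalue C \<Omega> (rayleigh \<Omega> u g)"
proof -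
  let ?m = "rayleigh \<Omega> u g"
  have sq: "square_integrable \<Omega> v" "square_integrable \<Omega> h" if "(v, h) \<in> H10 C \<Omega>" for v h
    using that by (auto simp: H10_def H1_def)
  have nn: "0 \<le> (LINT x:\<Omega>|lebesgue. (p x)\<^sup>2)" for p :: "'a \<Rightarrow> real"
    by (auto simp: set_lebesgue_integral_def)
  have le: "?m * (LINT x:\<Omega>|lebesgue. (v x)\<^sup>2) \<le> (LINT x:\<Omega>|lebesgue. (norm (h x))\<^sup>2)"
    if vh: "(v, h) \<in> H10 C \<Omega>" for v h
  proof (cases "null_function \<Omega> v")
    case True
    then show ?thesis using null_function_iff[OF sq(1)[OF vh]] nn[of "\<lambda>x. norm (h x)"] by simp
  next
    case False
    then have "0 < (LINT x:\<Omega>|lebesgue. (v x)\<^sup>2)"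
      using null_function_iff[OF sq(1)[OF vh]] nn[of v] by simp
    then show ?thesis using min[OF vh False] by (simp add: rayleigh_def field_simps)
  qed
  have u0: "(LINT x:\<Omega>|lebesgue. (u x)\<^sup>2) \<noteq> 0"
    using null_function_iff[OF sq(1)[OF u(1)]] u(2) by simp
  then have eq: "(LINT x:\<Omega>|lebesgue. (norm (g x))\<^sup>2) = ?m * (LINT x:\<Omega>|lebesgue. (u x)\<^sup>2)"
    by (simp add: rayleigh_def)
  have "(LINT x:\<Omega>|lebesgue. g x \<bullet> h x) = ?m * (LINT x:\<Omega>|lebesgue. u x * v x)"
    if vh: "(v, h) \<in> H10 C \<Omega>" for v h
  proof -
    have "0 \<le> 2 * t * ((LINT x:\<Omega>|lebesgue. g x \<bullet> h x) - ?m * (LINT x:\<Omega>|lebesgue. u x * v x)) +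
      t\<^sup>2 * ((LINT x:\<Omega>|lebesgue. (norm (h x))\<^sup>2) - ?m * (LINT x:\<Omega>|lebesgue. (v x)\<^sup>2))" for t
      using le[OF H10_lincomb[OF assms(1) u(1) vh, of t]] eq
        integral_square_lincomb[OF sq(2)[OF u(1)] sq(2)[OF vh], of t]
        integral_square_lincomb[OF sq(1)[OF u(1)] sq(1)[OF vh], of t]
      by (simp add: algebra_simps)
    from quadratic_nonneg_imp_zero[OF this] show ?thesis by simp
  qed
  then show ev: "mixed_eigenvalue C \<Omega> ?m"
    using u unfolding mixed_eigenvalue_def by fast
  have "?m \<le> \<mu>" if "mixed_eigenvalue C \<Omega> \<mu>" for \<mu>
  proof -
    have "\<exists>w k. (w, k) \<in> H10 C \<Omega> \<and> \<not> null_function \<Omega> w \<and>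
        (\<forall>(v, h)\<in>H10 C \<Omega>.
          (LINT x:\<Omega>|lebesgue. k x \<bullet> h x) = \<mu> * (LINT x:\<Omega>|lebesgue. w x * v x))"
      using that unfolding mixed_eigenvalue_def by (elim bexE) (simp only: split_paired_all prod.case, blast)
    then obtain w k where w: "(w, k) \<in> H10 C \<Omega>" "\<not> null_function \<Omega> w"
      and t: "\<forall>(v, h)\<in>H10 C \<Omega>.
        (LINT x:\<Omega>|lebesgue. k x \<bullet> h x) = \<mu> * (LINT x:\<Omega>|lebesgue. w x * v x)"
      by blast
    from bspec[OF t w(1)] have "(LINT x:\<Omega>|lebesgue. k x \<bullet> k x) = \<mu> * (LINT x:\<Omega>|lebesgue. w x * w x)" by simp
    then have "(LINT x:\<Omega>|lebesgue. (norm (k x))\<^sup>2) = \<mu> * (LINT x:\<Omega>|lebesgue. (w x)\<^sup>2)"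
      by (simp add: power2_norm_eq_inner power2_eq_square[of "w _"])
    moreover have "(LINT x:\<Omega>|lebesgue. (w x)\<^sup>2) \<noteq> 0"
      using null_function_iff[OF sq(1)[OF w(1)]] w(2) by simp
    ultimately have "rayleigh \<Omega> w k = \<mu>" by (simp add: rayleigh_def)
    then show ?thesis using min[OF w] by simp
  qed
  then show "first_eigenvalue C \<Omega> = ereal ?m"
    unfolding first_eigenvalue_def using ev
    by (intro antisym INF_lower INF_greatest) auto
qed

end

theory Submission
  imports Defs
begin

text \<open>
  For \<open>\<phi>\<close> in \<open>C1c \<Omega> (\<Omega> \<union> Gamma1 C \<Omega>)\<close> and \<open>v = \<phi>\<^sup>2\<close>, a field \<open>\<psi>\<close> with compact support in \<open>C\<close> meets
  the support of \<open>\<phi>\<close> in a compact subset of \<open>\<Omega>\<close>, because \<open>Gamma1 C \<Omega>\<close> lies outside \<open>C\<close>.  Hence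
  \<open>\<psi>\<close> times a \<open>C\<^sup>1\<close> regularization \<open>S (n (v - t))\<close> of the indicator of \<open>{v > t}\<close> can be integrated by
  parts in \<open>\<Omega>\<close> without boundary terms.  Letting \<open>n\<close> tend to infinity bounds the relative perimeter of \<open>{v > t}\<close> by the lower limit of the integrals
  of \<open>n S' (n (v - t)) |grad v|\<close>; integrating over \<open>t\<close> (Fatou, Tonelli) gives the coarea inequality
  \<open>h \<integral> v \<le> \<integral> |grad v|\<close>.  Young's inequality turns it into \<open>h\<^sup>2 / 4 \<integral> \<phi>\<^sup>2 \<le> \<integral> |grad \<phi>|\<^sup>2\<close>, which passes
  to the closure \<open>H10\<close> and applies to an eigenfunction tested with itself.
\<close>

section \<open>Integration by parts for compactly supported fields\<close>

lemma has_derivative_zero_on_open: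
  assumes "(f has_derivative f') (at x)" "open U" "x \<in> U" "\<And>y. y \<in> U \<Longrightarrow> f y = 0"
  shows "f' = (\<lambda>h. 0)"
proof -
  have "(f has_derivative (\<lambda>h. 0)) (at x)"
    using assms(2-4)
    by (intro has_derivative_transform_within_open[of "\<lambda>_. 0" "\<lambda>h. 0" x UNIV U f])
       (auto intro: derivative_eq_intros)
  with assms(1) show ?thesis by (rule has_derivative_unique)
qed

lemma integrable_continuous_compact_support:
  fixes f :: "'a::euclidean_space \<Rightarrow> real"
  assumes "continuous_on UNIV f" "compact K" "\<And>x. x \<notin> K \<Longrightarrow> f x = 0"
  shows "integrable lborel f"
proof -
  have "integrable lborel (\<lambda>x. indicator K x *\<^sub>R f x)"
    using assms by (intro borel_integrable_compact continuous_on_subset[OF assms(1)]) auto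
  also have "(\<lambda>x. indicator K x *\<^sub>R f x) = f"
    using assms(3) by (auto simp: fun_eq_iff split: split_indicator)
  finally show ?thesis .
qed

lemma set_integrable_compact_support:
  fixes f :: "'a::euclidean_space \<Rightarrow> real"
  assumes "continuous_on U f" "compact K" "K \<subseteq> U" "\<And>x. x \<in> U - K \<Longrightarrow> f x = 0"
  shows "set_integrable lebesgue U f"
proof -
  have "integrable lborel (\<lambda>x. indicator K x *\<^sub>R f x)"
    using assms by (intro borel_integrable_compact continuous_on_subset[OF assms(1)]) auto
  moreover have "(\<lambda>x. indicator K x *\<^sub>R f x) = (\<lambda>x. indicator U x *\<^sub>R f x)"
    using assms(3,4) by (auto simp: fun_eq_iff split: split_indicator)
  ultimately show ?thesis by (simp add: set_integrable_def integrable_completion)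
qed

text \<open>The difference quotients of \<open>f\<close> have integral zero by translation invariance.\<close>

lemma integral_directional_derivative:
  fixes f :: "'a::euclidean_space \<Rightarrow> real"
  assumes der: "\<And>x. (f has_derivative f' x) (at x)"
    and cont: "continuous_on UNIV (\<lambda>x. f' x b)"
    and K: "compact K" "\<And>x. x \<notin> K \<Longrightarrow> f x = 0"
  shows "(LINT x|lborel. f' x b) = 0"
proof -
  have f'0: "f' x b = 0" if "x \<notin> K" for x
    using has_derivative_zero_on_open[OF der, of "- K" x] K that
    by (auto simp: compact_imp_closed open_Compl)
  have contf: "continuous_on UNIV f"
    using der by (auto simp: continuous_on_eq_continuous_at intro: has_derivative_continuous)
  have intf: "integrable lborel f"
    using contf K by (rule integrable_continuous_compact_support)
  have "compact ((\<lambda>x. f' x b) ` K)"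
    using cont K(1) by (intro compact_continuous_image) (auto intro: continuous_on_subset)
  then obtain M0 where M0: "\<And>x. x \<in> K \<Longrightarrow> \<bar>f' x b\<bar> \<le> M0"
    by (metis compact_imp_bounded bounded_iff imageI real_norm_def)
  define M where "M = max 0 M0"
  have M: "\<bar>f' x b\<bar> \<le> M" for x
    using M0[of x] f'0[of x] by (cases "x \<in> K") (auto simp: M_def)
  obtain R where R: "\<And>x. x \<in> K \<Longrightarrow> norm x \<le> R"
    using compact_imp_bounded[OF K(1)] by (auto simp: bounded_iff)
  define s where "s n = 1 / real (Suc n)" for n
  have s: "0 < s n" "s n \<le> 1" for n by (auto simp: s_def)
  define q where "q n x = (f (s n *\<^sub>R b + x) - f x) / s n" for n x
  have dline: "((\<lambda>r. f (r *\<^sub>R b + x)) has_real_derivative f' (r *\<^sub>R b + x) b) (at r)" for r x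
  proof -
    have "((\<lambda>r. f (r *\<^sub>R b + x)) has_derivative (\<lambda>h. f' (r *\<^sub>R b + x) (h *\<^sub>R b))) (at r)"
      by (rule has_derivative_compose[OF _ der]) (auto intro!: derivative_eq_intros)
    moreover have "f' (r *\<^sub>R b + x) (h *\<^sub>R b) = f' (r *\<^sub>R b + x) b * h" for h
      using linear_scale[OF has_derivative_linear[OF der]] by (simp add: mult.commute)
    ultimately show ?thesis by (simp add: has_field_derivative_def)
  qed
  have lim: "(\<lambda>n. q n x) \<longlonglongrightarrow> f' x b" for x
  proof -
    have "(\<lambda>h. (f (h *\<^sub>R b + x) - f x) / h) \<midarrow>0\<rightarrow> f' x b"
      using dline[of x 0] by (simp add: DERIV_def)
    moreover have "filterlim s (at 0) sequentially"
    proof -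
      have "s = (\<lambda>n. inverse (real (Suc n)))" by (auto simp: s_def inverse_eq_divide)
      then have "s \<longlonglongrightarrow> 0" using LIMSEQ_inverse_real_of_nat by simp
      then show ?thesis unfolding filterlim_at using s(1) by (auto simp: less_imp_neq[symmetric] intro!: always_eventually)

    qed
    ultimately show ?thesis unfolding q_def by (rule filterlim_compose)
  qed
  have bound: "norm (q n x) \<le> indicator (cball 0 (R + norm b)) x *\<^sub>R M" for n x
  proof (cases "x \<in> cball 0 (R + norm b)")
    case True
    have "norm (f (s n *\<^sub>R b + x) - f (0 *\<^sub>R b + x)) \<le> M * norm (s n - 0)"
      using M dline by (intro field_differentiable_bound[of UNIV _ "\<lambda>r. f' (r *\<^sub>R b + x) b"])
        (auto intro: DERIV_subset)
    then show ?thesis using True s(1)[of n] by (simp add: q_def field_simps)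
  next
    case False
    have "norm x \<le> norm (s n *\<^sub>R b + x) + norm (s n *\<^sub>R b)"
      using norm_triangle_ineq4[of "s n *\<^sub>R b + x" "s n *\<^sub>R b"] by simp
    moreover have "norm (s n *\<^sub>R b) \<le> norm b" using s[of n] by (simp add: mult_left_le_one_le)
    ultimately have "norm (s n *\<^sub>R b + x) > R" "norm x > R"
      using False norm_ge_zero[of b] by (auto simp del: norm_ge_zero)
    then have "x \<notin> K" "s n *\<^sub>R b + x \<notin> K" using R by fastforce+
    then show ?thesis using K(2) False by (simp add: q_def)
  qed
  have trans: "integrable lborel (\<lambda>x. f (c + x)) \<and> (LINT x|lborel. f (c + x)) = (LINT x|lborel. f x)" for c
  proof -
    have "integrable (distr lborel borel ((+) c)) f" using intf by (simp add: lborel_distr_plus)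
    moreover have "(LINT x|distr lborel borel ((+) c). f x) = (LINT x|lborel. f x)"
      by (simp add: lborel_distr_plus)
    moreover have "f \<in> borel_measurable borel" using contf by (rule borel_measurable_continuous_onI)
    ultimately show ?thesis by (subst (asm) integrable_distr_eq, simp, simp, subst (asm) integral_distr) auto
  qed
  have q0: "(LINT x|lborel. q n x) = 0" for n
    using trans intf unfolding q_def by simp
  have mf: "f \<in> borel_measurable borel" using contf by (rule borel_measurable_continuous_onI)
  have "(\<lambda>n. LINT x|lborel. q n x) \<longlonglongrightarrow> (LINT x|lborel. f' x b)"
  proof (rule integral_dominated_convergence)
    show "integrable lborel (\<lambda>x. indicator (cball 0 (R + norm b)) x *\<^sub>R M)"
      by (intro borel_integrable_compact) auto
    show "(\<lambda>x. f' x b) \<in> borel_measurable lborel"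
      using borel_measurable_continuous_onI[OF cont] by simp
    show "q n \<in> borel_measurable lborel" for n unfolding q_def using mf by measurable
  qed (use lim bound in auto)
  then show ?thesis unfolding q0 by (simp add: LIMSEQ_const_iff)
qed

lemma integral_divergence_product:
  fixes w :: "'a::euclidean_space \<Rightarrow> real" and \<psi> :: "'a \<Rightarrow> 'a"
  assumes U: "open U"
    and w: "\<And>x. x \<in> U \<Longrightarrow> (w has_derivative blinfun_apply (w' x)) (at x)" "continuous_on U w'"
    and \<psi>: "\<And>x. x \<in> U \<Longrightarrow> (\<psi> has_derivative blinfun_apply (\<psi>' x)) (at x)" "continuous_on U \<psi>'"
    and K: "compact K" "K \<subseteq> U" "\<And>x. x \<in> U - K \<Longrightarrow> w x = 0 \<or> \<psi> x = 0"
  shows "(LINT x:U|lebesgue. w x * (\<Sum>b\<in>Basis. \<psi>' x b \<bullet> b) + w' x (\<psi> x)) = 0"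
proof -
  have cw: "continuous_on U w" and c\<psi>: "continuous_on U \<psi>"
    using w(1) \<psi>(1) by (auto intro!: continuous_at_imp_continuous_on intro: has_derivative_continuous)
  define D where "D b x = (if x \<in> U then w x * (\<psi>' x b \<bullet> b) + w' x b * (\<psi> x \<bullet> b) else 0)" for b x
  have UK: "open (- K)" using K(1) by (simp add: compact_imp_closed open_Compl)
  have *: "integrable lborel (D b) \<and> (LINT x|lborel. D b x) = 0" for b
  proof -
    define f where "f x = (if x \<in> U then w x * (\<psi> x \<bullet> b) else 0)" for x
    define f' where "f' x h = (if x \<in> U then w x * (\<psi>' x h \<bullet> b) + w' x h * (\<psi> x \<bullet> b) else 0)" for x h
    have D: "D b = (\<lambda>x. f' x b)" by (auto simp: D_def f'_def)
    have f0: "f x = 0" if "x \<notin> K" for x using K(3)[of x] that by (auto simp: f_def)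
    have der: "(f has_derivative f' x) (at x)" for x
    proof (cases "x \<in> U")
      case True
      have "((\<lambda>x. w x * (\<psi> x \<bullet> b)) has_derivative (\<lambda>h. w x * (\<psi>' x h \<bullet> b) + w' x h * (\<psi> x \<bullet> b))) (at x)"
        using w(1)[OF True] \<psi>(1)[OF True] by (auto intro!: derivative_eq_intros)
      then have "(f has_derivative (\<lambda>h. w x * (\<psi>' x h \<bullet> b) + w' x h * (\<psi> x \<bullet> b))) (at x)"
        by (rule has_derivative_transform_within_open[OF _ U True]) (simp add: f_def)
      then show ?thesis using True by (simp add: f'_def[abs_def])
    next
      case False
      then have "(f has_derivative (\<lambda>h. 0)) (at x)" using K(2) f0
        by (intro has_derivative_transform_within_open[of "\<lambda>_. 0" "\<lambda>h. 0" x UNIV "- K" f])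
           (auto intro: derivative_eq_intros UK)
      then show ?thesis using False by (simp add: f'_def[abs_def])
    qed
    have f'0: "f' x b = 0" if "x \<notin> K" for x
      using has_derivative_zero_on_open[OF der UK, of x] that f0 by auto
    have "continuous_on U (\<lambda>x. f' x b)"
      by (rule continuous_on_eq[of U "\<lambda>x. w x * (\<psi>' x b \<bullet> b) + w' x b * (\<psi> x \<bullet> b)"])
         (auto simp: f'_def intro!: continuous_intros cw c\<psi> w(2) \<psi>(2))
    moreover have "continuous_on (- K) (\<lambda>x. f' x b)"
      by (rule continuous_on_eq[of _ "\<lambda>x. 0"]) (auto simp: f'0)
    moreover have "U \<union> - K = UNIV" using K(2) by auto
    ultimately have cont: "continuous_on UNIV (\<lambda>x. f' x b)"
      using continuous_on_open_Un[OF U UK] by metis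
    show ?thesis unfolding D
      using integral_directional_derivative[OF der cont K(1) f0]
        integrable_continuous_compact_support[OF cont K(1) f'0] by blast
  qed
  have eq: "indicator U x *\<^sub>R (w x * (\<Sum>b\<in>Basis. \<psi>' x b \<bullet> b) + w' x (\<psi> x)) = (\<Sum>b\<in>Basis. D b x)" for x
  proof -
    have "w' x (\<psi> x) = w' x (\<Sum>b\<in>Basis. (\<psi> x \<bullet> b) *\<^sub>R b)" by (simp add: euclidean_representation)
    also have "\<dots> = (\<Sum>b\<in>Basis. w' x b * (\<psi> x \<bullet> b))"
      by (simp add: blinfun.sum_right blinfun.scaleR_right mult.commute)
    finally show ?thesis by (cases "x \<in> U") (auto simp: D_def sum.distrib sum_distrib_left)
  qed
  have "(LINT x:U|lebesgue. w x * (\<Sum>b\<in>Basis. \<psi>' x b \<bullet> b) + w' x (\<psi> x)) =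
      (LINT x|lebesgue. (\<Sum>b\<in>Basis. D b x))"
    unfolding set_lebesgue_integral_def eq ..
  also have "\<dots> = (LINT x|lborel. (\<Sum>b\<in>Basis. D b x))"
    using * borel_measurable_integrable by (intro integral_completion borel_measurable_sum) blast
  also have "\<dots> = (\<Sum>b\<in>Basis. LINT x|lborel. D b x)"
    using * by (intro Bochner_Integration.integral_sum) auto
  also have "\<dots> = 0" using * by simp
  finally show ?thesis .
qed

section \<open>A continuously differentiable approximation of the Heaviside function\<close>

definition soft_step :: "real \<Rightarrow> real" where
  "soft_step y = (max 0 y)\<^sup>2 / (1 + (max 0 y)\<^sup>2)"

definition soft_step' :: "real \<Rightarrow> real" where
  "soft_step' y = 2 * max 0 y / (1 + (max 0 y)\<^sup>2)\<^sup>2"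

lemma DERIV_max_power2: "((\<lambda>y::real. (max 0 y)\<^sup>2) has_real_derivative 2 * max 0 y) (at y)"
proof -
  consider "y < 0" | "y > 0" | "y = 0" by linarith
  then show ?thesis
  proof cases
    case 1
    have "((\<lambda>y::real. 0) has_real_derivative 0) (at y)" by simp
    then have "((\<lambda>y::real. (max 0 y)\<^sup>2) has_real_derivative 0) (at y)"
      by (rule has_field_derivative_transform_within_open[of _ _ _ "{..<0}"]) (use 1 in auto)
    then show ?thesis using 1 by simp
  next
    case 2
    have "((\<lambda>y::real. y\<^sup>2) has_real_derivative 2 * y) (at y)"
      by (auto intro!: derivative_eq_intros)
    then have "((\<lambda>y::real. (max 0 y)\<^sup>2) has_real_derivative 2 * y) (at y)"
      by (rule has_field_derivative_transform_within_open[of _ _ _ "{0<..}"]) (use 2 in auto)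
    then show ?thesis using 2 by simp
  next
    case 3
    have "((\<lambda>h::real. (max 0 h)\<^sup>2 / h) \<longlongrightarrow> 0) (at 0)"
    proof (rule Lim_null_comparison)
      show "\<forall>\<^sub>F h::real in at 0. norm ((max 0 h)\<^sup>2 / h) \<le> \<bar>h\<bar>"
        by (auto simp: max_def power2_eq_square)
      show "((\<lambda>h::real. \<bar>h\<bar>) \<longlongrightarrow> 0) (at 0)" by (auto intro!: tendsto_eq_intros)
    qed
    then show ?thesis using 3 by (simp add: DERIV_def)
  qed
qed

lemma DERIV_soft_step: "(soft_step has_real_derivative soft_step' y) (at y)"
proof -
  have p: "1 + (max 0 y)\<^sup>2 \<noteq> 0" for y :: real by (smt (verit) zero_le_power2)
  have "((\<lambda>y. (max 0 y)\<^sup>2 / (1 + (max 0 y)\<^sup>2)) has_real_derivative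
      (2 * max 0 y * (1 + (max 0 y)\<^sup>2) - (max 0 y)\<^sup>2 * (0 + 2 * max 0 y)) /
      ((1 + (max 0 y)\<^sup>2) * (1 + (max 0 y)\<^sup>2))) (at y)"
    by (intro DERIV_divide DERIV_add DERIV_const DERIV_max_power2 p)
  moreover have "2 * max 0 y * (1 + (max 0 y)\<^sup>2) - (max 0 y)\<^sup>2 * (0 + 2 * max 0 y) = 2 * max 0 y"
    by (simp add: algebra_simps)
  ultimately show ?thesis
    by (simp add: soft_step_def[abs_def] soft_step'_def power2_eq_square)
qed

lemma soft_step_range: "0 \<le> soft_step y" "soft_step y \<le> 1"
  by (auto simp: soft_step_def divide_le_eq add_pos_nonneg)

lemma soft_step_nonpos: "y \<le> 0 \<Longrightarrow> soft_step y = 0"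
  and soft_step'_nonpos: "y \<le> 0 \<Longrightarrow> soft_step' y = 0"
  by (auto simp: soft_step_def soft_step'_def)

lemma soft_step'_nonneg: "0 \<le> soft_step' y"
  by (auto simp: soft_step'_def)

lemma continuous_soft_step: "continuous_on A soft_step"
  by (rule continuous_on_subset[OF DERIV_continuous_on[of UNIV]])
     (auto intro: DERIV_soft_step)

lemma continuous_soft_step': "continuous_on A soft_step'"
proof -
  have p: "1 + (max 0 y)\<^sup>2 \<noteq> 0" for y :: real by (smt (verit) zero_le_power2)
  show ?thesis unfolding soft_step'_def[abs_def]
    by (intro continuous_intros) (use p in auto)
qed

lemma measurable_soft_step' [measurable]: "soft_step' \<in> borel_measurable borel"
  by (intro borel_measurable_continuous_onI continuous_soft_step')

lemma tendsto_soft_step: "(\<lambda>n. soft_step (real n * d)) \<longlonglongrightarrow> of_bool (0 < d)"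
proof (cases "0 < d")
  case True
  have "filterlim (\<lambda>n. 1 + (real n * d)\<^sup>2) at_top sequentially"
    using True
    by (intro filterlim_tendsto_add_at_top[OF tendsto_const] filterlim_pow_at_top
        filterlim_at_top_mult_tendsto_pos[OF tendsto_const] filterlim_real_sequentially) auto
  then have "(\<lambda>n. 1 - inverse (1 + (real n * d)\<^sup>2)) \<longlonglongrightarrow> 1 - 0"
    by (intro tendsto_diff tendsto_const tendsto_inverse_0_at_top)
  moreover have "soft_step (real n * d) = 1 - inverse (1 + (real n * d)\<^sup>2)" for n
  proof -
    have "1 + (real n * d)\<^sup>2 > 0" by (intro add_pos_nonneg) auto
    then show ?thesis using True by (simp add: soft_step_def field_simps)
  qed
  ultimately show ?thesis using True by simp
next
  case False
  then have "soft_step (real n * d) = 0" for n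
    by (intro soft_step_nonpos) (auto simp: mult_nonneg_nonpos)
  then show ?thesis using False by simp
qed

lemma nn_integral_soft_step'_le:
  "(\<integral>\<^sup>+t. indicator {0..} t * ennreal (real n * soft_step' (real n * (y - t))) \<partial>lborel) \<le> 1"
proof (cases "0 \<le> y")
  case True
  have z: "soft_step' (real n * (y - t)) = 0" if "y < t" for t
    using that by (intro soft_step'_nonpos) (auto simp: mult_nonneg_nonpos)
  have "(\<integral>\<^sup>+t. indicator {0..} t * ennreal (real n * soft_step' (real n * (y - t))) \<partial>lborel) =
      (\<integral>\<^sup>+t. ennreal (real n * soft_step' (real n * (y - t))) * indicator {0..y} t \<partial>lborel)"
    using z by (intro nn_integral_cong) (auto split: split_indicator)
  also have "\<dots> = ennreal (- soft_step (real n * (y - y)) - (- soft_step (real n * (y - 0))))"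
  proof (rule nn_integral_FTC_Icc)
    show "(\<lambda>t. real n * soft_step' (real n * (y - t))) \<in> borel_measurable borel" by measurable
    show "DERIV (\<lambda>t. - soft_step (real n * (y - t))) t :> real n * soft_step' (real n * (y - t))" for t
    proof -
      have "DERIV (\<lambda>t. - soft_step (real n * (y - t))) t :> - (soft_step' (real n * (y - t)) * (real n * (0 - 1)))"
        by (intro DERIV_minus DERIV_chain2[OF DERIV_soft_step] DERIV_cmult DERIV_diff DERIV_const DERIV_ident)
      then show ?thesis by (simp add: mult.commute)
    qed
  qed (use True soft_step'_nonneg in auto)
  also have "\<dots> \<le> 1"
    using soft_step_range[of "real n * y"] by (simp add: soft_step_nonpos)
  finally show ?thesis .
next
  case False
  then have "soft_step' (real n * (y - t)) = 0" if "0 \<le> t" for t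
    using that by (intro soft_step'_nonpos) (auto simp: mult_nonneg_nonpos)
  then have "(\<integral>\<^sup>+t. indicator {0..} t * ennreal (real n * soft_step' (real n * (y - t))) \<partial>lborel) =
      (\<integral>\<^sup>+(t::real). 0 \<partial>lborel)"
    by (intro nn_integral_cong) (auto split: split_indicator)
  then show ?thesis by simp
qed


section \<open>The coarea inequality\<close>

lemma C1c_divergence:
  fixes \<psi> :: "'a::euclidean_space \<Rightarrow> 'a"
  assumes "open C" "\<psi> \<in> C1c C C"
  obtains \<psi>' L where "\<And>x. x \<in> C \<Longrightarrow> (\<psi> has_derivative blinfun_apply (\<psi>' x)) (at x)"
    "continuous_on C \<psi>" "continuous_on C \<psi>'" "compact L" "L \<subseteq> C" "\<And>x. x \<in> C - L \<Longrightarrow> \<psi> x = 0"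
    "\<And>x. x \<in> C \<Longrightarrow> divergence \<psi> x = (\<Sum>b\<in>Basis. \<psi>' x b \<bullet> b)" "\<And>x. x \<in> C - L \<Longrightarrow> divergence \<psi> x = 0"
proof -
  obtain \<psi>' L where *: "\<And>x. x \<in> C \<Longrightarrow> (\<psi> has_derivative blinfun_apply (\<psi>' x)) (at x)"
    "continuous_on C \<psi>" "continuous_on C \<psi>'" "compact L" "L \<subseteq> C" "\<And>x. x \<in> C - L \<Longrightarrow> \<psi> x = 0"
    using assms(2) unfolding C1c_def by (auto simp: Ball_def)
  have d: "divergence \<psi> x = (\<Sum>b\<in>Basis. \<psi>' x b \<bullet> b)" if "x \<in> C" for x
    using frechet_derivative_at[OF *(1)[OF that], symmetric] by (simp add: divergence_def)
  have "divergence \<psi> x = 0" if "x \<in> C - L" for x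
  proof -
    have "open (C - L)" using assms(1) *(4) by (simp add: compact_imp_closed open_Diff)
    then have "blinfun_apply (\<psi>' x) = (\<lambda>h. 0)"
      using *(1)[of x] *(6) that by (intro has_derivative_zero_on_open[of \<psi> _ x "C - L"]) auto
    then show ?thesis using d[of x] that by simp
  qed
  then show thesis using * d by (intro that)
qed

lemma integral_divergence_superlevel_le:
  fixes v :: "'a::euclidean_space \<Rightarrow> real" and G :: "'a \<Rightarrow> 'a"
  assumes "open C" "open \<Omega>" "\<Omega> \<subseteq> C" "compact K" "K \<inter> C \<subseteq> \<Omega>"
    and v0: "\<And>x. x \<in> \<Omega> - K \<Longrightarrow> v x = 0"
    and der: "\<And>x. x \<in> \<Omega> \<Longrightarrow> (v has_derivative (\<lambda>h. G x \<bullet> h)) (at x)"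
    and contG: "continuous_on \<Omega> G" and "0 \<le> t"
    and \<psi>: "\<psi> \<in> C1c C C" "\<And>x. x \<in> C \<Longrightarrow> norm (\<psi> x) \<le> 1"
  shows "ennreal (LINT x:{x \<in> \<Omega>. t < v x}|lebesgue. divergence \<psi> x) \<le>
    liminf (\<lambda>n. \<integral>\<^sup>+x. ennreal (real n * soft_step' (real n * (v x - t))) * ennreal (indicator \<Omega> x * norm (G x)) \<partial>lborel)"
    (is "_ \<le> liminf ?H")
proof -
  obtain \<psi>' L where p: "\<And>x. x \<in> C \<Longrightarrow> (\<psi> has_derivative blinfun_apply (\<psi>' x)) (at x)"
    "continuous_on C \<psi>" "continuous_on C \<psi>'" "compact L" "L \<subseteq> C" "\<And>x. x \<in> C - L \<Longrightarrow> \<psi> x = 0"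
    "\<And>x. x \<in> C \<Longrightarrow> divergence \<psi> x = (\<Sum>b\<in>Basis. \<psi>' x b \<bullet> b)" "\<And>x. x \<in> C - L \<Longrightarrow> divergence \<psi> x = 0"
    by (rule C1c_divergence[OF assms(1) \<psi>(1)]) (rule that)
  have cv: "continuous_on \<Omega> v"
    using der by (auto intro!: continuous_at_imp_continuous_on intro: has_derivative_continuous)
  have cd: "continuous_on C (divergence \<psi>)"
    by (rule continuous_on_eq[of C "\<lambda>x. \<Sum>b\<in>Basis. \<psi>' x b \<bullet> b"])
       (auto simp: p(7) intro!: continuous_intros p(3))
  have c\<Omega>: "continuous_on \<Omega> \<psi>" "continuous_on \<Omega> \<psi>'" "continuous_on \<Omega> (divergence \<psi>)"
    using p(2,3) cd assms(3) by (auto intro: continuous_on_subset)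
  have KL: "compact (K \<inter> L)" "K \<inter> L \<subseteq> \<Omega>"
    using assms(4,5) p(4,5) by auto
  define w where "w n x = soft_step (real n * (v x - t))" for n x
  define w' where "w' n x = (real n * soft_step' (real n * (v x - t))) *\<^sub>R blinfun_inner_right (G x)" for n x
  have dw: "(w n has_derivative blinfun_apply (w' n x)) (at x)" if "x \<in> \<Omega>" for n x
  proof -
    have "((\<lambda>x. real n * (v x - t)) has_derivative (\<lambda>h. real n * (G x \<bullet> h))) (at x)"
      using der[OF that] by (auto intro!: derivative_eq_intros)
    from has_derivative_compose[OF this DERIV_soft_step[unfolded has_field_derivative_def]]
    moreover have "blinfun_apply (w' n x) = (\<lambda>h. soft_step' (real n * (v x - t)) * (real n * (G x \<bullet> h)))"
      by (auto simp: w'_def blinfun.scaleR_left)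
    ultimately show ?thesis by (simp add: w_def[abs_def])
  qed
  have cc: "continuous_on \<Omega> (\<lambda>x. soft_step' (real n * (v x - t)))" for n
    by (rule continuous_on_compose2[OF continuous_soft_step'[of UNIV]]) (auto intro!: continuous_intros cv)
  have cw: "continuous_on \<Omega> (w n)" for n unfolding w_def[abs_def]
    by (rule continuous_on_compose2[OF continuous_soft_step[of UNIV]]) (auto intro!: continuous_intros cv)
  have cw': "continuous_on \<Omega> (w' n)" for n unfolding w'_def
    by (intro continuous_intros cc bounded_linear.continuous_on[OF bounded_linear_blinfun_inner_right] contG)
  have neg: "real n * (0 - t) \<le> 0" for n using assms(9) by simp
  have w0: "w n x = 0" "w' n x = 0" if "x \<in> \<Omega> - K" for n x
    using v0[OF that] soft_step_nonpos[OF neg] soft_step'_nonpos[OF neg] by (simp_all add: w_def w'_def)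
  have supp: "x \<in> C" "x \<notin> K \<or> x \<in> C - L" if "x \<in> \<Omega> - K \<inter> L" for x using that assms(3) by auto
  have i1: "set_integrable lebesgue \<Omega> (\<lambda>x. w n x * divergence \<psi> x)" for n
    using supp w0 p(8) by (intro set_integrable_compact_support[OF _ KL] continuous_intros cw c\<Omega>) fastforce
  have i2: "set_integrable lebesgue \<Omega> (\<lambda>x. w' n x (\<psi> x))" for n
    using supp w0 p(6) by (intro set_integrable_compact_support[OF _ KL] continuous_intros cw' c\<Omega>) fastforce
  have "(LINT x:\<Omega>|lebesgue. w n x * (\<Sum>b\<in>Basis. \<psi>' x b \<bullet> b) + w' n x (\<psi> x)) = 0" for n
    using p(1) assms(3) dw cw' c\<Omega> supp w0 p(6)
    by (intro integral_divergence_product[OF assms(2) _ _ _ _ KL]) (auto; blast)+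
  moreover have "(LINT x:\<Omega>|lebesgue. w n x * (\<Sum>b\<in>Basis. \<psi>' x b \<bullet> b) + w' n x (\<psi> x)) =
      (LINT x:\<Omega>|lebesgue. w n x * divergence \<psi> x) + (LINT x:\<Omega>|lebesgue. w' n x (\<psi> x))" for n
    unfolding set_integral_add(2)[OF i1 i2, symmetric]
    using assms(2,3) p(7) by (intro set_lebesgue_integral_cong) auto
  ultimately have parts: "(LINT x:\<Omega>|lebesgue. w n x * divergence \<psi> x) = - (LINT x:\<Omega>|lebesgue. w' n x (\<psi> x))" for n
    by (metis eq_neg_iff_add_eq_0)
  have le: "ennreal (LINT x:\<Omega>|lebesgue. w n x * divergence \<psi> x) \<le> ?H n" for n
  proof -
    have "ennreal (LINT x:\<Omega>|lebesgue. w n x * divergence \<psi> x) \<le> ennreal (norm (LINT x:\<Omega>|lebesgue. w' n x (\<psi> x)))"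
      unfolding parts by (intro ennreal_leI) simp
    also have "\<dots> \<le> (\<integral>\<^sup>+x. ennreal (norm (indicator \<Omega> x *\<^sub>R w' n x (\<psi> x))) \<partial>lebesgue)"
      unfolding set_lebesgue_integral_def
      using i2 by (intro integral_norm_bound_ennreal) (simp add: set_integrable_def)
    also have "\<dots> = (\<integral>\<^sup>+x. ennreal (norm (indicator \<Omega> x *\<^sub>R w' n x (\<psi> x))) \<partial>lborel)"
      by (rule nn_integral_completion)
    also have "\<dots> \<le> ?H n"
    proof (intro nn_integral_mono)
      fix x
      have "norm (w' n x (\<psi> x)) \<le> real n * soft_step' (real n * (v x - t)) * norm (G x)" if "x \<in> \<Omega>"
      proof -
        have "\<bar>G x \<bullet> \<psi> x\<bar> \<le> norm (G x) * norm (\<psi> x)" by (rule Cauchy_Schwarz_ineq2)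
        also have "\<dots> \<le> norm (G x)" using \<psi>(2)[of x] that assms(3) by (intro mult_left_le) auto
        finally show ?thesis
          by (simp add: w'_def blinfun.scaleR_left abs_mult soft_step'_nonneg mult_left_mono)
      qed
      then show "ennreal (norm (indicator \<Omega> x *\<^sub>R w' n x (\<psi> x))) \<le>
          ennreal (real n * soft_step' (real n * (v x - t))) * ennreal (indicator \<Omega> x * norm (G x))"
        by (cases "x \<in> \<Omega>") (auto simp: ennreal_mult'[symmetric] soft_step'_nonneg intro!: ennreal_leI)
    qed
    finally show ?thesis .
  qed
  have m\<Omega>: "\<Omega> \<in> sets lebesgue" using assms(2) by auto
  have idiv: "set_integrable lebesgue \<Omega> (divergence \<psi>)"
    using set_integrable_compact_support[OF cd p(4,5,8)] m\<Omega> assms(3) by (rule set_integrable_subset)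
  let ?E = "{x \<in> \<Omega>. t < v x}"
  have "(\<lambda>n. LINT x:\<Omega>|lebesgue. w n x * divergence \<psi> x) \<longlonglongrightarrow> (LINT x:?E|lebesgue. divergence \<psi> x)"
    unfolding set_lebesgue_integral_def
  proof (rule integral_dominated_convergence)
    show "integrable lebesgue (\<lambda>x. norm (indicator \<Omega> x *\<^sub>R divergence \<psi> x))"
      using idiv by (intro integrable_norm) (simp add: set_integrable_def)
    show "(\<lambda>x. indicator \<Omega> x *\<^sub>R (w n x * divergence \<psi> x)) \<in> borel_measurable lebesgue" for n
      using i1[of n] unfolding set_integrable_def by (rule borel_measurable_integrable)
    have *: "(\<lambda>n. indicator \<Omega> x *\<^sub>R (w n x * divergence \<psi> x)) \<longlonglongrightarrow> indicator ?E x *\<^sub>R divergence \<psi> x" for x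
    proof (cases "x \<in> \<Omega>")
      case True
      have "(\<lambda>n. w n x * divergence \<psi> x) \<longlonglongrightarrow> of_bool (0 < v x - t) * divergence \<psi> x"
        unfolding w_def by (intro tendsto_intros tendsto_soft_step)
      then show ?thesis using True by (simp add: indicator_def of_bool_def)
    qed simp
    then show "AE x in lebesgue. (\<lambda>n. indicator \<Omega> x *\<^sub>R (w n x * divergence \<psi> x)) \<longlonglongrightarrow> indicator ?E x *\<^sub>R divergence \<psi> x"
      by simp
    show "(\<lambda>x. indicator ?E x *\<^sub>R divergence \<psi> x) \<in> borel_measurable lebesgue"
      by (rule borel_measurable_LIMSEQ_metric[OF _ *])
         (use i1 in \<open>auto simp: set_integrable_def dest: borel_measurable_integrable\<close>)
    show "AE x in lebesgue. norm (indicator \<Omega> x *\<^sub>R (w n x * divergence \<psi> x)) \<le>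
        norm (indicator \<Omega> x *\<^sub>R divergence \<psi> x)" for n
      using soft_step_range by (auto simp: w_def abs_mult intro!: mult_left_le_one_le split: split_indicator)
  qed
  then have "(\<lambda>n. ennreal (LINT x:\<Omega>|lebesgue. w n x * divergence \<psi> x)) \<longlonglongrightarrow>
      ennreal (LINT x:?E|lebesgue. divergence \<psi> x)"
    by (intro tendsto_ennrealI)
  then have "ennreal (LINT x:?E|lebesgue. divergence \<psi> x) =
      liminf (\<lambda>n. ennreal (LINT x:\<Omega>|lebesgue. w n x * divergence \<psi> x))"
    by (simp add: lim_imp_Liminf)
  also have "\<dots> \<le> liminf ?H" by (intro Liminf_mono) (simp add: le)
  finally show ?thesis .
qed

lemma relative_perimeter_superlevel_le:
  fixes v :: "'a::euclidean_space \<Rightarrow> real" and G :: "'a \<Rightarrow> 'a"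
  assumes "open C" "open \<Omega>" "\<Omega> \<subseteq> C" "compact K" "K \<inter> C \<subseteq> \<Omega>"
    and v0: "\<And>x. x \<in> \<Omega> - K \<Longrightarrow> v x = 0"
    and der: "\<And>x. x \<in> \<Omega> \<Longrightarrow> (v has_derivative (\<lambda>h. G x \<bullet> h)) (at x)"
    and contG: "continuous_on \<Omega> G" and "0 \<le> t"
  shows "relative_perimeter C {x \<in> \<Omega>. t < v x} \<le> enn2ereal
    (liminf (\<lambda>n. \<integral>\<^sup>+x. ennreal (real n * soft_step' (real n * (v x - t))) * ennreal (indicator \<Omega> x * norm (G x)) \<partial>lborel))"
    (is "_ \<le> enn2ereal ?X")
  unfolding relative_perimeter_def
proof (intro SUP_least)
  fix \<psi> :: "'a \<Rightarrow> 'a" assume "\<psi> \<in> {\<psi> \<in> C1c C C. \<forall>x\<in>C. norm (\<psi> x) \<le> 1}"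
  then have "ennreal (LINT x:{x \<in> \<Omega>. t < v x}|lebesgue. divergence \<psi> x) \<le> ?X" (is "ennreal ?a \<le> _")
    using integral_divergence_superlevel_le[OF assms] by blast
  then have "enn2ereal (ennreal ?a) \<le> enn2ereal ?X" by (simp add: less_eq_ennreal.rep_eq)
  moreover have "ereal ?a \<le> enn2ereal (ennreal ?a)"
    by (cases "0 \<le> ?a") (auto simp: enn2ereal_ennreal ennreal_neg zero_ennreal.rep_eq)
  ultimately show "ereal ?a \<le> enn2ereal ?X" by (rule order_trans[rotated])
qed

lemma relative_perimeter_nonneg: "0 \<le> relative_perimeter C (E :: 'a::euclidean_space set)"
proof -
  have "(\<lambda>_. 0 :: 'a) \<in> C1c C C" for C :: "'a set" by (auto simp: C1c_def zero_blinfun.rep_eq intro!: exI[of _ "\<lambda>_. 0"])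
  moreover have "divergence (\<lambda>_. 0 :: 'a) x = 0" for x :: 'a by (simp add: divergence_def)
  ultimately show ?thesis unfolding relative_perimeter_def
    by (intro SUP_upper2[of "\<lambda>_. 0"]) (auto simp: set_lebesgue_integral_def)
qed

lemma relative_cheeger_nonneg: "0 \<le> relative_cheeger C \<Omega>"
  unfolding relative_cheeger_def
  by (intro INF_greatest) (auto intro!: zero_le_divide_ereal simp: relative_perimeter_nonneg)

lemma cheeger_superlevel_le:
  assumes "0 \<le> c" "ereal c \<le> relative_cheeger C \<Omega>" "bounded \<Omega>" "E \<in> sets borel" "E \<subseteq> \<Omega>"
    and P: "relative_perimeter C E \<le> enn2ereal X"
  shows "ennreal c * emeasure lborel E \<le> X"
proof -
  have "bounded E" using assms(3,5) bounded_subset by blast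
  then have fin: "emeasure lborel E \<noteq> \<infinity>" using emeasure_bounded_finite by fastforce
  have mE: "measure lebesgue E = measure lborel E" "emeasure lborel E = ennreal (measure lborel E)"
    using assms(4) fin emeasure_eq_ennreal_measure[of lborel E] by (auto simp: measure_completion)
  show ?thesis
  proof (cases "measure lborel E = 0")
    case False
    then have pos: "0 < measure lborel E" by (simp add: zero_less_measure_iff)
    have "E \<in> sets lebesgue" using assms(4) by auto
    then have "relative_cheeger C \<Omega> \<le> relative_perimeter C E / ereal (measure lebesgue E)"
      unfolding relative_cheeger_def using assms(5) pos mE by (intro INF_lower) auto
    then have "ereal c \<le> relative_perimeter C E / ereal (measure lborel E)"
      using assms(2) mE(1) by (metis order_trans)
    then have "ereal c * ereal (measure lborel E) \<le> relative_perimeter C E"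
      using pos by (subst (asm) ereal_le_divide_pos) (auto simp: mult.commute)
    then have "ereal (c * measure lborel E) \<le> enn2ereal X" using P by simp
    then have "ennreal (c * measure lborel E) \<le> X"
      using assms(1) by (simp add: less_eq_ennreal.rep_eq enn2ereal_ennreal)
    then show ?thesis using assms(1) mE(2) by (simp add: ennreal_mult')
  qed (use mE in simp)
qed


lemma cheeger_coarea:
  fixes v :: "'a::euclidean_space \<Rightarrow> real" and G :: "'a \<Rightarrow> 'a"
  assumes dom: "open C" "open \<Omega>" "\<Omega> \<subseteq> C" "compact K" "K \<inter> C \<subseteq> \<Omega>"
    and v0: "\<And>x. x \<in> \<Omega> - K \<Longrightarrow> v x = 0"
    and der: "\<And>x. x \<in> \<Omega> \<Longrightarrow> (v has_derivative (\<lambda>h. G x \<bullet> h)) (at x)"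
    and contG: "continuous_on \<Omega> G" and v_nonneg: "\<And>x. x \<in> \<Omega> \<Longrightarrow> 0 \<le> v x"
    and "bounded \<Omega>" and c: "0 \<le> c" "ereal c \<le> relative_cheeger C \<Omega>"
  shows "ennreal c * (\<integral>\<^sup>+x. ennreal (indicator \<Omega> x * v x) \<partial>lborel) \<le>
    (\<integral>\<^sup>+x. ennreal (indicator \<Omega> x * norm (G x)) \<partial>lborel)"
proof -
  define u where "u x = indicator \<Omega> x * v x" for x
  define B where "B x = ennreal (indicator \<Omega> x * norm (G x))" for x
  define k where "k n x t = ennreal (real n * soft_step' (real n * (u x - t)))" for n x t
  have cv: "continuous_on \<Omega> v"
    using der by (auto intro!: continuous_at_imp_continuous_on intro: has_derivative_continuous)
  have [measurable]: "\<Omega> \<in> sets borel" using dom(2) by simp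
  have [measurable]: "u \<in> borel_measurable borel"
    using borel_measurable_continuous_on_indicator[OF _ cv] by (simp add: u_def[abs_def])
  have [measurable]: "B \<in> borel_measurable borel"
    using borel_measurable_continuous_on_indicator[OF _ continuous_on_norm[OF contG]]
    by (simp add: B_def[abs_def])
  have u_nonneg: "0 \<le> u x" for x using v_nonneg[of x] by (simp add: u_def split: split_indicator)
  have level: "{x. t < u x} = {x \<in> \<Omega>. t < v x}" if "0 \<le> t" for t
    using that by (auto simp: u_def split: split_indicator_asm)
  have *: "ennreal c * emeasure lborel {x. t < u x} \<le> liminf (\<lambda>n. \<integral>\<^sup>+x. k n x t * B x \<partial>lborel)"
    if "0 \<le> t" for t
  proof (rule cheeger_superlevel_le[OF c \<open>bounded \<Omega>\<close>])
    show "{x. t < u x} \<in> sets borel" by measurable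
    show "{x. t < u x} \<subseteq> \<Omega>" using level[OF that] by auto
    have "k n x t * B x = ennreal (real n * soft_step' (real n * (v x - t))) * ennreal (indicator \<Omega> x * norm (G x))"
      for n x by (cases "x \<in> \<Omega>") (auto simp: k_def B_def u_def)
    then show "relative_perimeter C {x. t < u x} \<le> enn2ereal (liminf (\<lambda>n. \<integral>\<^sup>+x. k n x t * B x \<partial>lborel))"
      unfolding level[OF that] using relative_perimeter_superlevel_le[OF dom v0 der contG that] by simp
  qed
  have "(\<integral>\<^sup>+x. ennreal (u x) \<partial>lborel) =
      (\<integral>\<^sup>+x. (\<integral>\<^sup>+t. indicator {0..} t * indicator {x. t < u x} x \<partial>lborel) \<partial>lborel)"
  proof (intro nn_integral_cong)
    fix x
    have "(\<integral>\<^sup>+t. indicator {0..} t * indicator {x. t < u x} x \<partial>lborel) =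
        (\<integral>\<^sup>+t. indicator {0..<u x} t \<partial>lborel)"
      by (intro nn_integral_cong) (auto split: split_indicator)
    then show "ennreal (u x) = (\<integral>\<^sup>+t. indicator {0..} t * indicator {x. t < u x} x \<partial>lborel)"
      using u_nonneg[of x] by simp
  qed
  also have "\<dots> = (\<integral>\<^sup>+t. (\<integral>\<^sup>+x. indicator {0..} t * indicator {x. t < u x} x \<partial>lborel) \<partial>lborel)"
    by (rule lborel_pair.Fubini'[symmetric]) measurable
  also have "\<dots> = (\<integral>\<^sup>+t. indicator {0..} t * emeasure lborel {x. t < u x} \<partial>lborel)"
    by (intro nn_integral_cong) (simp add: nn_integral_cmult)
  finally have "ennreal c * (\<integral>\<^sup>+x. ennreal (u x) \<partial>lborel) =
      (\<integral>\<^sup>+t. ennreal c * (indicator {0..} t * emeasure lborel {x. t < u x}) \<partial>lborel)"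
    by (subst nn_integral_cmult) (simp_all add: lborel.measurable_emeasure)
  also have "\<dots> \<le> (\<integral>\<^sup>+t. liminf (\<lambda>n. indicator {0..} t * (\<integral>\<^sup>+x. k n x t * B x \<partial>lborel)) \<partial>lborel)"
    using * by (intro nn_integral_mono) (simp split: split_indicator)
  also have "\<dots> \<le> liminf (\<lambda>n. \<integral>\<^sup>+t. indicator {0..} t * (\<integral>\<^sup>+x. k n x t * B x \<partial>lborel) \<partial>lborel)"
    unfolding k_def by (intro nn_integral_liminf) measurable
  also have "\<dots> \<le> liminf (\<lambda>n. \<integral>\<^sup>+x. B x \<partial>lborel)"
  proof (intro Liminf_mono always_eventually allI)
    fix n
    have "(\<integral>\<^sup>+t. indicator {0..} t * (\<integral>\<^sup>+x. k n x t * B x \<partial>lborel) \<partial>lborel) =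
        (\<integral>\<^sup>+t. (\<integral>\<^sup>+x. indicator {0..} t * k n x t * B x \<partial>lborel) \<partial>lborel)"
      unfolding k_def by (subst nn_integral_cmult[symmetric]) (simp_all add: mult.assoc)
    also have "\<dots> = (\<integral>\<^sup>+x. (\<integral>\<^sup>+t. indicator {0..} t * k n x t * B x \<partial>lborel) \<partial>lborel)"
      unfolding k_def by (rule lborel_pair.Fubini') measurable
    also have "\<dots> = (\<integral>\<^sup>+x. (\<integral>\<^sup>+t. indicator {0..} t * k n x t \<partial>lborel) * B x \<partial>lborel)"
      unfolding k_def by (intro nn_integral_cong nn_integral_multc) measurable
    also have "\<dots> \<le> (\<integral>\<^sup>+x. 1 * B x \<partial>lborel)"
      unfolding k_def by (intro nn_integral_mono mult_right_mono nn_integral_soft_step'_le) auto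
    finally show "(\<integral>\<^sup>+t. indicator {0..} t * (\<integral>\<^sup>+x. k n x t * B x \<partial>lborel) \<partial>lborel) \<le> (\<integral>\<^sup>+x. B x \<partial>lborel)"
      by simp
  qed
  finally show ?thesis by (simp add: u_def B_def Liminf_const)
qed

section \<open>Bounds on the Rayleigh quotient\<close>

lemma cheeger_rayleigh_C1c:
  fixes \<phi> :: "'a::euclidean_space \<Rightarrow> real"
  assumes dom: "open C" "open \<Omega>" "\<Omega> \<subseteq> C" "bounded \<Omega>"
    and \<phi>: "\<phi> \<in> C1c \<Omega> (\<Omega> \<union> Gamma1 C \<Omega>)"
    and c: "0 \<le> c" "ereal c \<le> relative_cheeger C \<Omega>"
  shows "c\<^sup>2 / 4 * (LINT x:\<Omega>|lebesgue. (\<phi> x)\<^sup>2) \<le> (LINT x:\<Omega>|lebesgue. (norm (grad \<phi> x))\<^sup>2)"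
    (is "_ * ?A \<le> ?B")
proof (cases "c = 0")
  case True
  then show ?thesis by (simp add: set_lebesgue_integral_def)
next
  case False
  then have c0: "0 < c" using c(1) by simp
  have sub: "\<Omega> \<subseteq> \<Omega> \<union> Gamma1 C \<Omega>" by auto
  obtain \<phi>' K where p: "\<And>x. x \<in> \<Omega> \<Longrightarrow> (\<phi> has_derivative blinfun_apply (\<phi>' x)) (at x)"
    "\<And>x b. x \<in> \<Omega> \<Longrightarrow> partial_deriv b \<phi> x = \<phi>' x b"
    "continuous_on (\<Omega> \<union> Gamma1 C \<Omega>) \<phi>" "continuous_on (\<Omega> \<union> Gamma1 C \<Omega>) \<phi>'"
    "compact K" "K \<subseteq> \<Omega> \<union> Gamma1 C \<Omega>"
    "\<And>x. x \<in> \<Omega> \<union> Gamma1 C \<Omega> - K \<Longrightarrow> \<phi> x = 0" "\<And>x. x \<in> \<Omega> - K \<Longrightarrow> \<phi>' x = 0"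
    by (rule C1c_grad[OF dom(2) \<phi> sub]) (rule that)
  have KC: "K \<inter> C \<subseteq> \<Omega>"
    using p(6) dom(1) by (auto simp: Gamma1_def frontier_def interior_open)
  have grad: "\<phi>' x h = grad \<phi> x \<bullet> h" if "x \<in> \<Omega>" for x h
  proof -
    have "\<phi>' x h = \<phi>' x (\<Sum>b\<in>Basis. (h \<bullet> b) *\<^sub>R b)" by (simp add: euclidean_representation)
    also have "\<dots> = grad \<phi> x \<bullet> h"
      by (simp add: blinfun.sum_right blinfun.scaleR_right grad_def p(2)[OF that] inner_sum_left
          inner_commute[of h] mult.commute)
    finally show ?thesis .
  qed
  have cont: "continuous_on \<Omega> \<phi>" "continuous_on \<Omega> \<phi>'"
    using p(3,4) sub by (auto intro: continuous_on_subset)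
  have cg: "continuous_on \<Omega> (grad \<phi>)"
    by (rule continuous_on_eq[of \<Omega> "\<lambda>x. \<Sum>b\<in>Basis. \<phi>' x b *\<^sub>R b"])
       (auto simp: p(2) grad_def intro!: continuous_intros cont)
  have "((\<lambda>x. (\<phi> x)\<^sup>2) has_derivative (\<lambda>h. ((2 * \<phi> x) *\<^sub>R grad \<phi> x) \<bullet> h)) (at x)" if "x \<in> \<Omega>" for x
    using p(1)[OF that] by (auto intro!: derivative_eq_intros simp: grad[OF that])
  then have coarea: "ennreal c * (\<integral>\<^sup>+x. ennreal (indicator \<Omega> x * (\<phi> x)\<^sup>2) \<partial>lborel) \<le>
      (\<integral>\<^sup>+x. ennreal (indicator \<Omega> x * norm ((2 * \<phi> x) *\<^sub>R grad \<phi> x)) \<partial>lborel)"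
    using p(7) by (intro cheeger_coarea[OF dom(1-3) p(5) KC _ _ _ _ dom(4) c])
      (auto intro!: continuous_intros cont cg)
  note si = C1c_square_integrable[OF dom(2) sub \<phi>]
  have i1: "set_integrable lebesgue \<Omega> (\<lambda>x. (\<phi> x)\<^sup>2)"
    and i2: "set_integrable lebesgue \<Omega> (\<lambda>x. (norm (grad \<phi> x))\<^sup>2)"
    using si(1,3) by (auto simp: square_integrable_def)
  have young: "norm ((2 * \<phi> x) *\<^sub>R grad \<phi> x) \<le> c / 2 * (\<phi> x)\<^sup>2 + 2 / c * (norm (grad \<phi> x))\<^sup>2" for x
  proof -
    have "0 \<le> (c / 2 * \<bar>\<phi> x\<bar> - norm (grad \<phi> x))\<^sup>2 * (2 / c)" using c0 by simp
    also have "\<dots> = c / 2 * (\<phi> x)\<^sup>2 + 2 / c * (norm (grad \<phi> x))\<^sup>2 - norm ((2 * \<phi> x) *\<^sub>R grad \<phi> x)"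
      using c0 by (simp add: power2_diff field_simps abs_mult power2_eq_square)
    finally show ?thesis by simp
  qed
  have "ennreal (c * ?A) = ennreal c * (\<integral>\<^sup>+x. ennreal (indicator \<Omega> x * (\<phi> x)\<^sup>2) \<partial>lebesgue)"
    unfolding ennreal_mult'[OF less_imp_le[OF c0]]
    using i1 nn_integral_eq_integral[of lebesgue "\<lambda>x. indicator \<Omega> x * (\<phi> x)\<^sup>2"]
    by (auto simp: set_integrable_def set_lebesgue_integral_def)
  also have "\<dots> \<le> (\<integral>\<^sup>+x. ennreal (indicator \<Omega> x * norm ((2 * \<phi> x) *\<^sub>R grad \<phi> x)) \<partial>lebesgue)"
    using coarea by (simp only: nn_integral_completion)
  also have "\<dots> \<le> (\<integral>\<^sup>+x. ennreal (indicator \<Omega> x *\<^sub>R (c / 2 * (\<phi> x)\<^sup>2 + 2 / c * (norm (grad \<phi> x))\<^sup>2)) \<partial>lebesgue)"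
    using young by (intro nn_integral_mono ennreal_leI) (simp split: split_indicator)
  also have "\<dots> = ennreal (LINT x:\<Omega>|lebesgue. c / 2 * (\<phi> x)\<^sup>2 + 2 / c * (norm (grad \<phi> x))\<^sup>2)"
  proof -
    have "set_integrable lebesgue \<Omega> (\<lambda>x. c / 2 * (\<phi> x)\<^sup>2 + 2 / c * (norm (grad \<phi> x))\<^sup>2)"
      using i1 i2 by (intro set_integral_add set_integrable_mult_right) auto
    then show ?thesis unfolding set_integrable_def set_lebesgue_integral_def
      using c0 by (intro nn_integral_eq_integral) auto
  qed
  also have "(LINT x:\<Omega>|lebesgue. c / 2 * (\<phi> x)\<^sup>2 + 2 / c * (norm (grad \<phi> x))\<^sup>2) = c / 2 * ?A + 2 / c * ?B"
    using i1 i2 by (subst set_integral_add) auto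
  finally have "c * ?A \<le> c / 2 * ?A + 2 / c * ?B"
    using c0 by (subst (asm) ennreal_le_iff) (auto simp: set_lebesgue_integral_def intro!: add_nonneg_nonneg)
  then have "c / 2 * (c / 2 * ?A) \<le> c / 2 * (2 / c * ?B)" using c0 by (intro mult_left_mono) auto
  then show ?thesis using c0 by (simp add: power2_eq_square)
qed

lemma integral_square_sum_weighted_le:
  fixes f g :: "'a::euclidean_space \<Rightarrow> 'b::euclidean_space"
  assumes "square_integrable \<Omega> f" "square_integrable \<Omega> g" "0 < d"
  shows "(LINT x:\<Omega>|lebesgue. (norm (f x + g x))\<^sup>2) \<le>
    (1 + d) * (LINT x:\<Omega>|lebesgue. (norm (f x))\<^sup>2) + (1 + 1 / d) * (LINT x:\<Omega>|lebesgue. (norm (g x))\<^sup>2)"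
    (is "_ \<le> (1 + d) * ?F + (1 + 1 / d) * ?G")
proof -
  let ?X = "LINT x:\<Omega>|lebesgue. f x \<bullet> g x"
  have "0 \<le> (LINT x:\<Omega>|lebesgue. (norm (f x + (- 1 / d) *\<^sub>R g x))\<^sup>2)"
    by (auto simp: set_lebesgue_integral_def)
  also have "\<dots> = ?F + 2 * (- 1 / d) * ?X + (- 1 / d)\<^sup>2 * ?G"
    by (rule integral_square_lincomb[OF assms(1,2)])
  finally have "0 \<le> d * (?F + 2 * (- 1 / d) * ?X + (- 1 / d)\<^sup>2 * ?G)"
    using assms(3) by (intro mult_nonneg_nonneg) auto
  also have "\<dots> = d * ?F - 2 * ?X + 1 / d * ?G"
    using assms(3) by (simp add: field_simps power2_eq_square)
  finally have "2 * ?X \<le> d * ?F + 1 / d * ?G" by simp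
  then show ?thesis
    using integral_square_lincomb[OF assms(1,2), of 1] by (simp add: algebra_simps)
qed

lemma cheeger_rayleigh_H10:
  fixes C \<Omega> :: "'a::euclidean_space set"
  assumes dom: "open C" "open \<Omega>" "\<Omega> \<subseteq> C" "bounded \<Omega>"
    and u: "(u, g) \<in> H10 C \<Omega>"
    and c: "0 \<le> c" "ereal c \<le> relative_cheeger C \<Omega>"
  shows "c\<^sup>2 / 4 * (LINT x:\<Omega>|lebesgue. (u x)\<^sup>2) \<le> (LINT x:\<Omega>|lebesgue. (norm (g x))\<^sup>2)"
    (is "?c * ?U \<le> ?G")
proof -
  have sq: "square_integrable \<Omega> u" "square_integrable \<Omega> g" using u by (auto simp: H10_def H1_def)
  have sub: "\<Omega> \<subseteq> \<Omega> \<union> Gamma1 C \<Omega>" by auto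
  have approx: "?c * ?U \<le> (1 + d) * ((1 + d) * ?G + d) + ?c * d" if d: "0 < d" for d
  proof -
    \<comment> \<open>With this choice both error terms \<open>(1 + 1 / d) \<epsilon>\<^sup>2\<close> below are at most \<open>d\<close>.\<close>
    define \<epsilon> where "\<epsilon> = sqrt (d\<^sup>2 / (1 + d))"
    have "\<epsilon> > 0" using d by (simp add: \<epsilon>_def)
    then obtain \<phi> where \<phi>: "\<phi> \<in> C1c \<Omega> (\<Omega> \<union> Gamma1 C \<Omega>)"
      "H1_norm \<Omega> (\<lambda>x. u x - \<phi> x) (\<lambda>x. g x - grad \<phi> x) < \<epsilon>"
      using u by (auto simp: H10_def)
    note s\<phi> = C1c_square_integrable[OF dom(2) sub \<phi>(1)]
    let ?P = "LINT x:\<Omega>|lebesgue. (\<phi> x)\<^sup>2" and ?Q = "LINT x:\<Omega>|lebesgue. (norm (grad \<phi> x))\<^sup>2"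
    let ?a = "LINT x:\<Omega>|lebesgue. (u x - \<phi> x)\<^sup>2" and ?b = "LINT x:\<Omega>|lebesgue. (norm (g x - grad \<phi> x))\<^sup>2"
    have nn: "0 \<le> ?a" "0 \<le> ?b" by (auto simp: set_lebesgue_integral_def)
    have "?a + ?b < d\<^sup>2 / (1 + d)"
      using \<phi>(2) by (simp add: H1_norm_def \<epsilon>_def)
    then have ab: "?a < d\<^sup>2 / (1 + d)" "?b < d\<^sup>2 / (1 + d)" using nn by auto
    have small: "(1 + 1 / d) * r \<le> d" if "r < d\<^sup>2 / (1 + d)" for r
    proof -
      have e: "1 + 1 / d = (1 + d) / d" using d by (simp add: field_simps)
      have "(1 + 1 / d) * r \<le> (1 + 1 / d) * (d\<^sup>2 / (1 + d))" using that d by (intro mult_left_mono) auto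
      also have "\<dots> = (1 + d) / d * (d\<^sup>2 / (1 + d))" unfolding e ..
      also have "\<dots> = d" using d by (simp add: power2_eq_square)
      finally show ?thesis .
    qed
    have "square_integrable \<Omega> (\<lambda>x. u x - \<phi> x)"
      using square_integrable_lincomb[OF sq(1) s\<phi>(1), of "- 1"] by simp
    from integral_square_sum_weighted_le[OF s\<phi>(1) this d]
    have U: "?U \<le> (1 + d) * ?P + (1 + 1 / d) * ?a" by simp
    have "square_integrable \<Omega> (\<lambda>x. grad \<phi> x - g x)"
      using square_integrable_lincomb[OF s\<phi>(3) sq(2), of "- 1"] by simp
    from integral_square_sum_weighted_le[OF sq(2) this d]
    have Q: "?Q \<le> (1 + d) * ?G + (1 + 1 / d) * ?b" by (simp add: norm_minus_commute)
    have "?c * ?U \<le> ?c * ((1 + d) * ?P + d)"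
      using U small[OF ab(1)] by (intro mult_left_mono) auto
    also have "\<dots> = (1 + d) * (?c * ?P) + ?c * d" by (simp add: algebra_simps)
    also have "\<dots> \<le> (1 + d) * ?Q + ?c * d"
      using cheeger_rayleigh_C1c[OF dom \<phi>(1) c] d by (intro add_right_mono mult_left_mono) auto
    also have "\<dots> \<le> (1 + d) * ((1 + d) * ?G + d) + ?c * d"
      using Q small[OF ab(2)] d by (intro add_right_mono mult_left_mono) auto
    finally show ?thesis .
  qed
  have "((\<lambda>d. (1 + d) * ((1 + d) * ?G + d) + ?c * d) \<longlongrightarrow> (1 + 0) * ((1 + 0) * ?G + 0) + ?c * 0) (at_right 0)"
    by (intro tendsto_intros)
  then have "((\<lambda>d. (1 + d) * ((1 + d) * ?G + d) + ?c * d) \<longlongrightarrow> ?G) (at_right 0)" by simp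
  then show ?thesis
  proof (rule tendsto_lowerbound)
    show "\<forall>\<^sub>F d in at_right 0. ?c * ?U \<le> (1 + d) * ((1 + d) * ?G + d) + ?c * d"
      by (rule eventually_mono[OF eventually_at_right_less]) (rule approx)
  qed simp
qed

lemma mixed_eigenvalue_ge:
  fixes C \<Omega> :: "'a::euclidean_space set"
  assumes dom: "open C" "open \<Omega>" "\<Omega> \<subseteq> C" "bounded \<Omega>"
    and \<mu>: "mixed_eigenvalue C \<Omega> \<mu>"
    and c: "0 \<le> c" "ereal c \<le> relative_cheeger C \<Omega>"
  shows "c\<^sup>2 / 4 \<le> \<mu>"
proof -
  obtain u g where u: "(u, g) \<in> H10 C \<Omega>" "\<not> null_function \<Omega> u"
    and test: "\<forall>(v, h)\<in>H10 C \<Omega>. (LINT x:\<Omega>|lebesgue. g x \<bullet> h x) = \<mu> * (LINT x:\<Omega>|lebesgue. u x * v x)"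
    using \<mu> unfolding mixed_eigenvalue_def by (elim bexE) (simp only: split_paired_all prod.case, blast)
  let ?U = "LINT x:\<Omega>|lebesgue. (u x)\<^sup>2"
  have "(LINT x:\<Omega>|lebesgue. g x \<bullet> g x) = \<mu> * (LINT x:\<Omega>|lebesgue. u x * u x)"
    using bspec[OF test u(1)] by simp
  then have "(LINT x:\<Omega>|lebesgue. (norm (g x))\<^sup>2) = \<mu> * ?U"
    by (simp add: power2_norm_eq_inner power2_eq_square[of "u _"])
  then have le: "c\<^sup>2 / 4 * ?U \<le> \<mu> * ?U" using cheeger_rayleigh_H10[OF dom u(1) c] by simp
  have "square_integrable \<Omega> u" using u(1) by (auto simp: H10_def H1_def)
  then have "?U \<noteq> 0" using u(2) null_function_iff by blast
  moreover have "0 \<le> ?U" by (simp add: set_lebesgue_integral_def)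
  ultimately show ?thesis using le by simp
qed

theorem theorem3p9:
  fixes C \<Omega> :: "'a::euclidean_space set"
  assumes "DIM('a) \<ge> 2"
    and "lipschitz_domain C" and "\<not> bounded C"
    and "is_domain \<Omega>" and "bounded \<Omega>" and "\<Omega> \<subseteq> C"
    and "lipschitz_hypersurface (Gamma0 C \<Omega>)"
  shows "first_eigenvalue C \<Omega> \<ge> (relative_cheeger C \<Omega>)\<^sup>2 / 4"
  unfolding first_eigenvalue_def
proof (intro INF_greatest)
  fix \<mu> assume "\<mu> \<in> {\<mu>. mixed_eigenvalue C \<Omega> \<mu>}"
  then have ge: "c\<^sup>2 / 4 \<le> \<mu>" if "0 \<le> c" "ereal c \<le> relative_cheeger C \<Omega>" for c
    using assms that by (intro mixed_eigenvalue_ge[of C \<Omega>]) (auto simp: lipschitz_domain_def is_domain_def)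
  show "(relative_cheeger C \<Omega>)\<^sup>2 / 4 \<le> ereal \<mu>"
  proof (cases "relative_cheeger C \<Omega>")
    case (real r)
    then show ?thesis using ge[of r] relative_cheeger_nonneg[of C \<Omega>] by simp
  next
    case PInf
    have "(\<bar>\<mu>\<bar> + 2)\<^sup>2 / 4 \<le> \<mu>" using PInf by (intro ge) auto
    moreover have "4 * \<bar>\<mu>\<bar> < (\<bar>\<mu>\<bar> + 2)\<^sup>2" by (simp add: power2_sum add_nonneg_pos)
    ultimately show ?thesis by linarith
  next
    case MInf
    then show ?thesis using relative_cheeger_nonneg[of C \<Omega>] by simp
  qed
qed

end
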